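(* Let $\mathbb F$ be a field, $d\ge1$ an integer, $A=A(d,\mathbb F)$. Let $F$ be the free (associative, unital) $\mathbb F$-algebra on generators $s_1,\ldots,s_d$, and for $n\ge0$ let $F_n$ be the span of the words of length $n$ in $s_1,\ldots,s_d$ (with $F_0=\mathbb F1$). Consider the $\mathbb F$-algebra homomorphism $F\to A$ that sends $s_i\mapsto e_i-e^*_i$ for $1\le i\le d$. This map is an injection and its image is $\sum_{n=0}^\infty(A_{n+1}\cap A^*_{n+1})$. Moreover, for $n\ge0$ the image of $F_n$ is $A_{n+1}\cap A^*_{n+1}$.
   Context: Algebras are associative and have a $1$. For a field $\mathbb F$ and an integer $d\ge 1$, $A=A(d,\mathbb F)$ is the $\mathbb F$-algebra defined by generators $\{e_i\}_{i=0}^d$, $\{e^*_i\}_{i=0}^d$ and relations $e_ie_j=\delta_{i,j}e_i$, $e^*_ie^*_j=\delta_{i,j}e^*_i$ $(0\le i,j\le d)$, $1=\sum_{i=0}^d e_i$, $1=\sum_{i=0}^d e^*_i$. The $e_i,e_i^*$ are the idempotent generators; the $e^*_i$ are called starred and the $e_i$ nonstarred; $i$ is the index of $e_i$ and of $e^*_i$. There is a unique $\mathbb F$-algebra automorphism $*$ of $A$, written $x\mapsto x^*$, that swaps $e_i$ and $e^*_i$ for $0\le i\le d$. For $n\ge1$, a word of length $n$ in $A$ is a product $g_1g_2\cdots g_n$ of idempotent generators such that for $2\le j\le n$ exactly one of $g_{j-1},g_j$ is starred. It ends with $g_n$. The word is nonrepeating (NR) if $g_{j-1},g_j$ have different indices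 for $2\le j\le n$. For $n\ge1$, $A_n$ is the subspace of $A$ spanned by the NR words that have length $n$ and end with a nonstarred element, and $A^*_n$ is the image of $A_n$ under $*$ (the span of the NR words of length $n$ ending with a starred element). *)

theory Defs
  imports "HOL-Algebra.QuotRing" "HOL-Algebra.Module" "HOL-Library.Poly_Mapping"
begin

section \<open>Algebras over a field\<close>

text \<open>
  The ground field is a type of class \<^class>\<open>field\<close>; an algebra over it is a record of type
  \<^type>\<open>module\<close>, which has the operations of a ring (not assumed commutative) together with
  a scalar multiplication.
\<close>

definition alg_hom :: "('k, 'a) module \<Rightarrow> ('k, 'b) module \<Rightarrow> ('a \<Rightarrow> 'b) set" where
  "alg_hom M N = {h \<in> ring_hom M N. \<forall>c. \<forall>x\<in>carrier M. h (c \<odot>\<^bsub>M\<^esub> x) = c \<odot>\<^bsub>N\<^esub> h x}"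

definition lin_span :: "('k, 'a) module \<Rightarrow> 'a set \<Rightarrow> 'a set" where
  "lin_span M S = {\<Oplus>\<^bsub>M\<^esub>x\<in>T. c x \<odot>\<^bsub>M\<^esub> x | c T. finite T \<and> T \<subseteq> S}"

text \<open>The scalar multiplication on cosets is written in the style of \<^const>\<open>rcoset_mult\<close>.\<close>

definition quotient_algebra :: "('k, 'a) module \<Rightarrow> 'a set \<Rightarrow> ('k, 'a set) module" where
  "quotient_algebra M I =
    ring.extend (M Quot I) (module.fields (\<lambda>c X. \<Union>x\<in>X. I +>\<^bsub>M\<^esub> (c \<odot>\<^bsub>M\<^esub> x)))"


section \<open>Free algebras\<close>

text \<open>
  The free algebra on a set of letters is the monoid algebra of the free monoid. Lists are
  wrapped in a new type so that the free monoid can be made an (additively written,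
  noncommutative) instance of \<^class>\<open>monoid_add\<close>; the library's product of finitely
  supported functions on it is then the convolution product.
\<close>

datatype 'x free_monoid = FM (letters: "'x list")

instantiation free_monoid :: (type) monoid_add
begin

definition zero_free_monoid :: "'a free_monoid" where
  "0 = FM []"

definition plus_free_monoid :: "'a free_monoid \<Rightarrow> 'a free_monoid \<Rightarrow> 'a free_monoid" where
  "u + v = FM (letters u @ letters v)"

instance
  by standard (simp_all add: zero_free_monoid_def plus_free_monoid_def)

end

type_synonym ('k, 'x) free_alg = "'x free_monoid \<Rightarrow>\<^sub>0 'k"

definition word :: "'x list \<Rightarrow> ('k::field, 'x) free_alg" where
  "word xs = Poly_Mapping.single (FM xs) 1"

definition free_algebra :: "'x set \<Rightarrow> ('k::field, ('k, 'x) free_alg) module" where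
  "free_algebra X =
    \<lparr>carrier = {p. \<forall>w\<in>Poly_Mapping.keys p. set (letters w) \<subseteq> X},
     mult = (*), one = 1, zero = 0, add = (+),
     smult = (\<lambda>c. Poly_Mapping.map ((*) c))\<rparr>"

definition free_component :: "'x set \<Rightarrow> nat \<Rightarrow> ('k::field, 'x) free_alg set" where
  "free_component X n = lin_span (free_algebra X) (word ` {xs. set xs \<subseteq> X \<and> length xs = n})"


section \<open>The algebra \<open>A(d, \<bbbF>)\<close>\<close>

text \<open>\<open>Nonstarred i\<close> and \<open>Starred i\<close> are the symbols for the generators $e_i$ and $e^*_i$.\<close>

datatype idem_gen = Nonstarred (index: nat) | Starred (index: nat)

fun starred :: "idem_gen \<Rightarrow> bool" where
  "starred (Nonstarred i) = False"
| "starred (Starred i) = True"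

fun swap_star :: "idem_gen \<Rightarrow> idem_gen" where
  "swap_star (Nonstarred i) = Starred i"
| "swap_star (Starred i) = Nonstarred i"

definition idem_gens :: "nat \<Rightarrow> idem_gen set" where
  "idem_gens d = {g. index g \<le> d}"

definition relators :: "nat \<Rightarrow> ('k::field, idem_gen) free_alg set" where
  "relators d =
    {word [Nonstarred i] * word [Nonstarred j] - (if i = j then word [Nonstarred i] else 0)
      | i j. i \<le> d \<and> j \<le> d} \<union>
    {word [Starred i] * word [Starred j] - (if i = j then word [Starred i] else 0)
      | i j. i \<le> d \<and> j \<le> d} \<union>
    {1 - (\<Sum>i\<le>d. word [Nonstarred i]), 1 - (\<Sum>i\<le>d. word [Starred i])}"

text \<open>Ideals in \<^const>\<open>genideal\<close> are two-sided.\<close>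

definition rel_ideal :: "nat \<Rightarrow> ('k::field, idem_gen) free_alg set" where
  "rel_ideal d = Idl\<^bsub>free_algebra (idem_gens d)\<^esub> (relators d)"

definition alg_A :: "nat \<Rightarrow> ('k::field, ('k, idem_gen) free_alg set) module" where
  "alg_A d = quotient_algebra (free_algebra (idem_gens d)) (rel_ideal d)"

definition gen :: "nat \<Rightarrow> idem_gen \<Rightarrow> ('k::field, idem_gen) free_alg set" where
  "gen d g = rel_ideal d +>\<^bsub>free_algebra (idem_gens d)\<^esub> word [g]"

text \<open>
  The automorphism $*$. On the free algebra the exchange of $e_i$ and $e^*_i$ renames the
  letters of all words; since it preserves the ideal of relations, it takes cosets to cosets.
  (\<open>map_key f p\<close> is the composition of the coefficient function \<open>p\<close> with \<open>f\<close>, and the renaming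
  is its own inverse.)
\<close>

definition star :: "('k::field, idem_gen) free_alg set \<Rightarrow> ('k, idem_gen) free_alg set" where
  "star x = Poly_Mapping.map_key (map_free_monoid swap_star) ` x"

definition gen_prod :: "nat \<Rightarrow> idem_gen list \<Rightarrow> ('k::field, idem_gen) free_alg set" where
  "gen_prod d gs = foldr (mult (alg_A d)) (map (gen d) gs) (one (alg_A d))"

definition is_word :: "nat \<Rightarrow> idem_gen list \<Rightarrow> bool" where
  "is_word d gs \<longleftrightarrow>
    gs \<noteq> [] \<and> set gs \<subseteq> idem_gens d \<and> successively (\<lambda>g h. starred g \<noteq> starred h) gs"

definition nonrepeating :: "idem_gen list \<Rightarrow> bool" where
  "nonrepeating gs \<longleftrightarrow> successively (\<lambda>g h. index g \<noteq> index h) gs"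

definition NR_space :: "nat \<Rightarrow> nat \<Rightarrow> ('k::field, idem_gen) free_alg set set" where
  "NR_space d n = lin_span (alg_A d)
    (gen_prod d ` {gs. is_word d gs \<and> nonrepeating gs \<and> length gs = n \<and> \<not> starred (last gs)})"

definition NR_space_star :: "nat \<Rightarrow> nat \<Rightarrow> ('k::field, idem_gen) free_alg set set" where
  "NR_space_star d n = star ` NR_space d n"

definition s_maps :: "nat \<Rightarrow> (('k::field, nat) free_alg \<Rightarrow> ('k, idem_gen) free_alg set) set" where
  "s_maps d = {h \<in> alg_hom (free_algebra {1..d}) (alg_A d).
    \<forall>i\<in>{1..d}. h (word [i]) = gen d (Nonstarred i) \<ominus>\<^bsub>alg_A d\<^esub> gen d (Starred i)}"

end

theory Submission
  imports Defs Complex_Main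
begin

text \<open>
  Put $s_i = e_i - e^*_i$ for $0 \<le> i \<le> d$, so that $\sum_i s_i = 0$. For $i \<noteq> j$ one has
  $e_i e^*_j = s_i e^*_j$ and $e^*_i e_j = -s_i e_j$, so $A_{n+1}$ is the sum of the spaces
  $\overline{F_n} e_j$ and $A^*_{n+1}$ is the sum of the spaces $\overline{F_n} e^*_j$, where
  $\overline{F_n}$ is the image of $F_n$. Hence $A$ is generated by $e_0, \ldots, e_d$ as a left
  $F$-module. That these generators are free is seen from a right action of $A$ on $F^{d+1}$ which
  commutes with the left multiplication by $F$. Comparing the coordinates of
  $\sum_j f_j e_j = \sum_j g_j e^*_j$ with $f_j, g_j \<in> F_n$ gives
  $f_k = g_k - \sum_j g_j s_j$; since the last sum has degree $n + 1$, it vanishes, all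
  $g_j$ coincide and the element is the image of $g_0$.
\<close>

section \<open>Linear maps on free algebras\<close>

text \<open>The obstacle is to show that anything is nonzero in \<open>alg_A d\<close>, a quotient
  by an ideal known only through its generators. The action supplies the invariants: it kills
  \<open>rel_ideal d\<close>, so its values depend only on cosets. It is evaluated at
  \<open>const_vec d 1\<close>, because the row with all entries 1 stands for the sum of the e_k,
  which is 1 in A. Acting on this row by the lift of p returns p in each coordinate up to d; thus
  the action is a left inverse of F \<rightarrow> A, and injectivity is immediate. An isomorphism of
  A with F^{d+1} is never stated; soundness of the action, together with spanning, is enough.

  All computations take place on representatives in the free algebra, as congruences modulo
  \<open>rel_ideal d\<close>; cosets appear only where the definitions force them. Index 0 has no
  letter in F, hence the separate treatment of s_0 as minus the sum of the other s_i.\<close>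

lemma word_eq_iff [simp]: "word xs = (word ys :: ('k::field, 'x) free_alg) \<longleftrightarrow> xs = ys"
proof
  assume "word xs = (word ys :: ('k, 'x) free_alg)"
  then have "Poly_Mapping.keys (word xs :: ('k, 'x) free_alg) = Poly_Mapping.keys (word ys :: ('k, 'x) free_alg)"
    by simp
  then show "xs = ys" by (simp add: word_def)
qed simp

lemma word_Nil [simp]: "word [] = 1"
  by (simp add: word_def flip: zero_free_monoid_def single_one)

lemma word_append: "word (xs @ ys) = word xs * word ys"
  by (simp add: word_def mult_single plus_free_monoid_def)

lemma word_Cons: "word (x # xs) = word [x] * word xs"
  using word_append[of "[x]" xs] by simp

text \<open>A name for the scalar multiplication of \<open>free_algebra\<close>, under which the
  free algebra is a \<open>vector_space\<close>, so that spans and linear maps can be used.\<close>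

definition scl :: "'k::field \<Rightarrow> ('k, 'x) free_alg \<Rightarrow> ('k, 'x) free_alg" where
  "scl c = Poly_Mapping.map ((*) c)"

lemma scl_single [simp]: "scl c (Poly_Mapping.single w a) = Poly_Mapping.single w (c * a)"
  by (simp add: scl_def)

lemma lookup_scl [simp]: "Poly_Mapping.lookup (scl c p) w = c * Poly_Mapping.lookup p w"
  by (simp add: scl_def Poly_Mapping.map.rep_eq when_def)

global_interpretation fa: vector_space "scl :: 'k::field \<Rightarrow> ('k, 'x) free_alg \<Rightarrow> _"
  by unfold_locales (auto intro!: poly_mapping_eqI simp: lookup_add algebra_simps)

lemma scl_mult_left: "scl c (p * q) = scl c p * q"
  by (simp add: scl_def mult_map_scale_conv_mult mult.assoc)

lemma span_keys: "p \<in> fa.span (word ` letters ` Poly_Mapping.keys p)"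
proof -
  have "p = (\<Sum>w\<in>Poly_Mapping.keys p. scl (Poly_Mapping.lookup p w) (word (letters w)))"
    by (rule poly_mapping_eqI)
      (simp add: lookup_sum word_def lookup_single when_def sum.delta in_keys_iff if_distrib cong: if_cong)
  also have "\<dots> \<in> fa.span (word ` letters ` Poly_Mapping.keys p)"
    by (intro fa.span_sum fa.span_scale fa.span_base) auto
  finally show ?thesis .
qed

lemma carrier_free_algebra:
  "carrier (free_algebra X :: ('k::field, ('k, 'x) free_alg) module) = fa.span (word ` {xs. set xs \<subseteq> X})"
  (is "?C = ?S")
proof
  show "?C \<subseteq> ?S"
  proof
    fix p :: "('k, 'x) free_alg" assume "p \<in> ?C"
    then have "word ` letters ` Poly_Mapping.keys p \<subseteq> word ` {xs. set xs \<subseteq> X}"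
      by (auto simp: free_algebra_def)
    then show "p \<in> ?S"
      using span_keys[of p] fa.span_mono by blast
  qed
  show "?S \<subseteq> ?C"
  proof (rule fa.span_minimal)
    show "fa.subspace ?C"
    proof (rule fa.subspaceI)
      fix c :: 'k and p q :: "('k, 'x) free_alg"
      assume p: "p \<in> ?C"
      then show "scl c p \<in> ?C"
        by (simp add: free_algebra_def in_keys_iff)
      assume "q \<in> ?C"
      with p show "p + q \<in> ?C"
        using keys_add[of p q] by (auto simp: free_algebra_def)
    qed (simp add: free_algebra_def)
  qed (auto simp: free_algebra_def word_def)
qed

lemma in_span_words: "p \<in> fa.span (range word)"
  using span_keys[of p] fa.span_mono[of "word ` letters ` Poly_Mapping.keys p" "range word"] by blast

lemma scl_mult_right: "scl c (p * q) = p * scl c (q :: ('k::field, 'x) free_alg)"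
proof -
  \<comment> \<open>On the left, scalars pass by associativity. On the right, \<open>scl c 1\<close>
    has to be central, and this is checked on words.\<close>
  have "p * scl c 1 = scl c p"
    using in_span_words[of p]
  proof (induction rule: fa.span_induct_alt)
    case (step a x y)
    then obtain xs where "x = word xs" by auto
    then have "x * scl c 1 = scl c x"
      by (simp add: word_def mult_single flip: single_one)
    with step show ?case
      by (simp add: distrib_right fa.scale_right_distrib scl_mult_left[symmetric] mult.commute)
  qed simp
  then have "scl c (p * q) = p * scl c 1 * q"
    by (simp add: scl_mult_left)
  then show ?thesis
    by (simp add: mult.assoc scl_mult_left[symmetric])
qed

lemma linear_scl: "Vector_Spaces.linear scl scl f"
  if "\<And>p q. f (p + q) = f p + f q" "\<And>c p. f (scl c p) = scl c (f p)"
  for f :: "('k::field, 'x) free_alg \<Rightarrow> ('k, 'y) free_alg"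
  by unfold_locales (use that in auto)

lemma linear_mult_left: "Vector_Spaces.linear scl scl (\<lambda>p. p * (q :: ('k::field, 'x) free_alg))"
  by (rule linear_scl) (simp_all add: distrib_right scl_mult_left)

lemma linear_mult_right: "Vector_Spaces.linear scl scl (\<lambda>p. (q :: ('k::field, 'x) free_alg) * p)"
  by (rule linear_scl) (simp_all add: distrib_left scl_mult_right)

lemma linear_mem_span:
  fixes f :: "('k::field, 'x) free_alg \<Rightarrow> ('k, 'y) free_alg"
  assumes "Vector_Spaces.linear scl scl f" "x \<in> fa.span S" "\<And>a. a \<in> S \<Longrightarrow> f a \<in> fa.span T"
  shows "f x \<in> fa.span T"
proof -
  interpret Vector_Spaces.linear scl scl f by fact
  have "f x \<in> fa.span (f ` S)"
    using assms(2) span_image by blast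
  also have "\<dots> \<subseteq> fa.span T"
    using assms(3) by (intro fa.span_minimal) auto
  finally show ?thesis .
qed

lemma linear_eq_on_words:
  fixes f g :: "('k::field, 'x) free_alg \<Rightarrow> ('k, 'y) free_alg"
  assumes "Vector_Spaces.linear scl scl f" "Vector_Spaces.linear scl scl g"
    and "\<And>xs. word xs \<in> S \<Longrightarrow> f (word xs) = g (word xs)" "S \<subseteq> range word" "p \<in> fa.span S"
  shows "f p = g p"
proof -
  interpret f: Vector_Spaces.linear scl scl f by fact
  interpret g: Vector_Spaces.linear scl scl g by fact
  show ?thesis
    using assms(5)
  proof (induction rule: fa.span_induct_alt)
    case (step c x y)
    then show ?case using assms(3,4) by (auto simp: f.add g.add f.scale g.scale)
  qed simp
qed

lemma span_mult:
  fixes x y :: "('k::field, 'x) free_alg"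
  assumes "x \<in> fa.span S" "y \<in> fa.span T"
    and "\<And>a b. a \<in> S \<Longrightarrow> b \<in> T \<Longrightarrow> a * b \<in> fa.span U"
  shows "x * y \<in> fa.span U"
  by (rule linear_mem_span[OF linear_mult_left assms(1)],
      rule linear_mem_span[OF linear_mult_right assms(2)], rule assms(3))

text \<open>Linear extension of a map given on words. The lift F \<rightarrow> A, the exchange of
  stars, the right action and the division by a letter are all obtained from it.\<close>

definition lin :: "('x list \<Rightarrow> ('k, 'y) free_alg) \<Rightarrow> ('k::field, 'x) free_alg \<Rightarrow> ('k, 'y) free_alg" where
  "lin f p = (\<Sum>w\<in>Poly_Mapping.keys p. scl (Poly_Mapping.lookup p w) (f (letters w)))"

lemma linear_lin: "Vector_Spaces.linear scl scl (lin f)"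
proof (rule linear_scl)
  \<comment> \<open>Scaling by 0 shrinks the set of keys, so the sum must be allowed to run over a
    larger finite set.\<close>
  have *: "lin f p = (\<Sum>w\<in>W. scl (Poly_Mapping.lookup p w) (f (letters w)))"
    if "finite W" "Poly_Mapping.keys p \<subseteq> W" for W p
    unfolding lin_def using that by (intro sum.mono_neutral_left) (auto simp: in_keys_iff)
  show "lin f (p + q) = lin f p + lin f q" for p q
    unfolding lin_def
    by (rule setsum_keys_plus_distrib) (simp_all add: fa.scale_left_distrib)
  show "lin f (scl c p) = scl c (lin f p)" for c p
  proof -
    have "lin f (scl c p) = (\<Sum>w\<in>Poly_Mapping.keys p. scl (c * Poly_Mapping.lookup p w) (f (letters w)))"
      by (subst *[where W = "Poly_Mapping.keys p"]) (simp_all add: subset_iff in_keys_iff)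
    then show ?thesis
      by (simp add: lin_def fa.scale_sum_right)
  qed
qed

lemma lin_word [simp]: "lin f (word xs) = f xs"
  by (simp add: lin_def word_def)

lemmas lin_add = linear_lin[THEN Vector_Spaces.linear.axioms(3), THEN module_hom.add]
  and lin_scale = linear_lin[THEN Vector_Spaces.linear.axioms(3), THEN module_hom.scale]

lemma mult_hom_on_words:
  fixes f :: "('k::field, 'x) free_alg \<Rightarrow> ('k, 'y) free_alg"
  assumes "Vector_Spaces.linear scl scl f" "\<And>xs ys. f (word (xs @ ys)) = f (word xs) * f (word ys)"
  shows "f (p * q) = f p * f q"
proof -
  interpret f: Vector_Spaces.linear scl scl f by fact
  have w: "f (word xs * q) = f (word xs) * f q" for xs
    by (rule linear_eq_on_words[where S = "range word" and p = q and f = "\<lambda>q. f (word xs * q)"])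
      (simp_all add: linear_scl in_span_words
        distrib_left f.add f.scale assms(2) scl_mult_right[symmetric] word_append[symmetric])
  show ?thesis
    by (rule linear_eq_on_words[where S = "range word" and p = p and f = "\<lambda>p. f (p * q)"])
      (simp_all add: linear_scl in_span_words distrib_right f.add f.scale scl_mult_left[symmetric] w)
qed

abbreviation FA :: "'x set \<Rightarrow> ('k::field, 'x) free_alg set" where
  "FA X \<equiv> carrier (free_algebra X)"

lemma subspace_FA: "fa.subspace (FA X)"
  by (simp add: carrier_free_algebra)

lemmas FA_0 [simp] = fa.subspace_0[OF subspace_FA]
  and FA_add = fa.subspace_add[OF subspace_FA]
  and FA_diff = fa.subspace_diff[OF subspace_FA]
  and FA_uminus = fa.subspace_neg[OF subspace_FA]
  and FA_scl = fa.subspace_scale[OF subspace_FA]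
  and FA_sum = fa.subspace_sum[OF subspace_FA]

lemma FA_word: "set xs \<subseteq> X \<Longrightarrow> word xs \<in> FA X"
  by (simp add: carrier_free_algebra fa.span_base)

lemma FA_1 [simp]: "1 \<in> FA X"
  using FA_word[of "[]" X] by simp

lemma FA_mult: "p \<in> FA X \<Longrightarrow> q \<in> FA X \<Longrightarrow> p * q \<in> FA X"
  unfolding carrier_free_algebra
  by (erule (1) span_mult) (auto intro!: fa.span_base imageI simp flip: word_append)

lemmas FA_intros = FA_add FA_diff FA_uminus FA_scl FA_sum FA_word FA_mult

lemma free_algebra_sel [simp]:
  "mult (free_algebra X) = (*)" "one (free_algebra X) = 1" "zero (free_algebra X) = 0"
  "add (free_algebra X) = (+)" "smult (free_algebra X) = scl"
  by (simp_all add: free_algebra_def scl_def fun_eq_iff)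

lemma ring_free_algebra: "ring (free_algebra X)"
proof (rule ringI)
  show "abelian_group (free_algebra X)"
  proof (rule abelian_groupI)
    fix x assume "x \<in> FA X"
    then show "\<exists>y\<in>FA X. y \<oplus>\<^bsub>free_algebra X\<^esub> x = \<zero>\<^bsub>free_algebra X\<^esub>"
      using FA_uminus[of x X] by (intro bexI[of _ "- x"]) auto
  qed (simp_all add: FA_add algebra_simps)
  show "Group.monoid (free_algebra X)"
    by (rule monoidI) (simp_all add: FA_mult algebra_simps)
qed (simp_all add: algebra_simps)

text \<open>The bridge from \<open>lin_span\<close> in a module record to \<open>fa.span\<close>. It
  is applied to the identity of a free algebra and to the coset map onto \<open>alg_A d\<close>. The
  laws for scalars in \<open>M\<close> are pulled back along \<open>h\<close>.\<close>

lemma lin_span_image: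
  fixes M :: "('k::field, 'a) module" and h :: "('k, 'x) free_alg \<Rightarrow> 'a"
  assumes M: "abelian_monoid M" and V: "fa.subspace V"
    and h_closed: "\<And>p. p \<in> V \<Longrightarrow> h p \<in> carrier M"
    and h_zero: "h 0 = \<zero>\<^bsub>M\<^esub>"
    and h_add: "\<And>p q. p \<in> V \<Longrightarrow> q \<in> V \<Longrightarrow> h (p + q) = h p \<oplus>\<^bsub>M\<^esub> h q"
    and h_smult: "\<And>c p. p \<in> V \<Longrightarrow> h (scl c p) = c \<odot>\<^bsub>M\<^esub> h p"
    and W: "W \<subseteq> V"
  shows "lin_span M (h ` W) = h ` fa.span W"
proof
  interpret abelian_monoid M by fact
  have span_V: "fa.span W \<subseteq> V"
    using V W by (rule fa.span_minimal[rotated])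
  have smult_closed: "c \<odot>\<^bsub>M\<^esub> x \<in> carrier M" if "x \<in> h ` W" for c x
  proof -
    from that W obtain w where w: "x = h w" "w \<in> V" by auto
    then show ?thesis
      using h_closed[OF fa.subspace_scale[OF V w(2)], of c] h_smult[OF w(2), of c] by simp
  qed
  show "lin_span M (h ` W) \<subseteq> h ` fa.span W"
  proof
    fix y assume "y \<in> lin_span M (h ` W)"
    then obtain c T where "finite T" and T: "T \<subseteq> h ` W"
      and y: "y = (\<Oplus>\<^bsub>M\<^esub>x\<in>T. c x \<odot>\<^bsub>M\<^esub> x)"
      by (auto simp: lin_span_def)
    from \<open>finite T\<close> T have "(\<Oplus>\<^bsub>M\<^esub>x\<in>T. c x \<odot>\<^bsub>M\<^esub> x) \<in> h ` fa.span W"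
    proof (induction T rule: finite_induct)
      case empty
      show ?case using fa.span_zero[of W] by (simp add: h_zero[symmetric])
    next
      case (insert x T)
      then obtain p w where p: "p \<in> fa.span W" "(\<Oplus>\<^bsub>M\<^esub>x\<in>T. c x \<odot>\<^bsub>M\<^esub> x) = h p"
        and w: "w \<in> W" "x = h w" by auto
      have "(\<Oplus>\<^bsub>M\<^esub>x\<in>insert x T. c x \<odot>\<^bsub>M\<^esub> x) = c x \<odot>\<^bsub>M\<^esub> x \<oplus>\<^bsub>M\<^esub> (\<Oplus>\<^bsub>M\<^esub>x\<in>T. c x \<odot>\<^bsub>M\<^esub> x)"
        using insert smult_closed by (intro finsum_insert) auto
      also have "\<dots> = h (scl (c x) w + p)"
        using p w W span_V V by (simp add: h_add h_smult fa.subspace_scale subset_iff)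
      finally show ?case
        using p(1) w(1) by (simp add: fa.span_add fa.span_scale fa.span_base)
    qed
    then show "y \<in> h ` fa.span W" by (simp add: y)
  qed
  have "p \<in> V \<and> h p \<in> lin_span M (h ` W)" if "p \<in> fa.span W" for p
    using that
  proof (induction rule: fa.span_induct_alt)
    case base
    have "(\<Oplus>\<^bsub>M\<^esub>x\<in>{}. undefined \<odot>\<^bsub>M\<^esub> x) = h 0"
      by (simp add: h_zero)
    then show ?case
      unfolding lin_span_def using fa.subspace_0[OF V] by force
  next
    case (step a w p)
    then obtain c T where T: "finite T" "T \<subseteq> h ` W" and p: "h p = (\<Oplus>\<^bsub>M\<^esub>x\<in>T. c x \<odot>\<^bsub>M\<^esub> x)"
      by (auto simp: lin_span_def)
    have w: "w \<in> V" "h w \<in> h ` W" and "p \<in> V"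
      using step W by auto
    \<comment> \<open>\<open>lin_span\<close> sums over a set of vectors with one coefficient each.
      If \<open>h w\<close> already occurs in \<open>T\<close>, the new coefficient has to be merged
      with the old one.\<close>
    let ?R = "T - {h w}" and ?r = "if h w \<in> T then c (h w) else 0"
    let ?c = "c(h w := a + ?r)"
    have R: "finite ?R" "?R \<subseteq> h ` W" using T by auto
    have R_closed: "(\<Oplus>\<^bsub>M\<^esub>x\<in>?R. c x \<odot>\<^bsub>M\<^esub> x) \<in> carrier M"
      using R smult_closed by (intro finsum_closed) auto
    have p': "h p = ?r \<odot>\<^bsub>M\<^esub> h w \<oplus>\<^bsub>M\<^esub> (\<Oplus>\<^bsub>M\<^esub>x\<in>?R. c x \<odot>\<^bsub>M\<^esub> x)"
    proof (cases "h w \<in> T")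
      case True
      then have "h p = (\<Oplus>\<^bsub>M\<^esub>x\<in>insert (h w) ?R. c x \<odot>\<^bsub>M\<^esub> x)"
        using p by (simp add: insert_absorb)
      also have "\<dots> = c (h w) \<odot>\<^bsub>M\<^esub> h w \<oplus>\<^bsub>M\<^esub> (\<Oplus>\<^bsub>M\<^esub>x\<in>?R. c x \<odot>\<^bsub>M\<^esub> x)"
        using R w smult_closed by (intro finsum_insert) auto
      finally show ?thesis using True by simp
    next
      case False
      moreover have "0 \<odot>\<^bsub>M\<^esub> h w = \<zero>\<^bsub>M\<^esub>"
        using h_smult[OF w(1), of 0] h_zero by simp
      ultimately show ?thesis
        using p R_closed by simp
    qed
    have "h (scl a w + p) = a \<odot>\<^bsub>M\<^esub> h w \<oplus>\<^bsub>M\<^esub> h p"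
      using w \<open>p \<in> V\<close> V by (simp add: h_add h_smult fa.subspace_scale)
    also have "\<dots> = (a \<odot>\<^bsub>M\<^esub> h w \<oplus>\<^bsub>M\<^esub> ?r \<odot>\<^bsub>M\<^esub> h w) \<oplus>\<^bsub>M\<^esub> (\<Oplus>\<^bsub>M\<^esub>x\<in>?R. c x \<odot>\<^bsub>M\<^esub> x)"
      unfolding p' using w R_closed smult_closed by (intro a_assoc[symmetric]) auto
    also have "a \<odot>\<^bsub>M\<^esub> h w \<oplus>\<^bsub>M\<^esub> ?r \<odot>\<^bsub>M\<^esub> h w = (a + ?r) \<odot>\<^bsub>M\<^esub> h w"
      using w V by (simp only: h_add[symmetric] h_smult[symmetric] fa.subspace_scale fa.scale_left_distrib)
    also have "(\<Oplus>\<^bsub>M\<^esub>x\<in>?R. c x \<odot>\<^bsub>M\<^esub> x) = (\<Oplus>\<^bsub>M\<^esub>x\<in>?R. ?c x \<odot>\<^bsub>M\<^esub> x)"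
      using R smult_closed by (intro finsum_cong') auto
    also have "(a + ?r) \<odot>\<^bsub>M\<^esub> h w \<oplus>\<^bsub>M\<^esub> (\<Oplus>\<^bsub>M\<^esub>x\<in>?R. ?c x \<odot>\<^bsub>M\<^esub> x)
        = (\<Oplus>\<^bsub>M\<^esub>x\<in>insert (h w) ?R. ?c x \<odot>\<^bsub>M\<^esub> x)"
      using R w smult_closed by (subst finsum_insert) auto
    finally have "h (scl a w + p) \<in> lin_span M (h ` W)"
      unfolding lin_span_def using R w by blast
    then show ?case
      using w \<open>p \<in> V\<close> V by (simp add: fa.subspace_add fa.subspace_scale)
  qed
  then show "h ` fa.span W \<subseteq> lin_span M (h ` W)" by auto
qed

lemma lin_span_free_algebra: "W \<subseteq> FA X \<Longrightarrow> lin_span (free_algebra X) W = fa.span W"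
  using lin_span_image[of "free_algebra X" "FA X" "\<lambda>p. p" W]
    abelian_group.axioms(1)[OF ring.is_abelian_group[OF ring_free_algebra, of X]]
  by (simp add: subspace_FA)

lemma free_component_eq: "free_component X n = fa.span (word ` {xs. set xs \<subseteq> X \<and> length xs = n})"
  unfolding free_component_def by (rule lin_span_free_algebra) (auto intro: FA_word)

section \<open>The quotient by the ideal of relations\<close>

abbreviation B :: "nat \<Rightarrow> ('k::field, idem_gen) free_alg set" where
  "B d \<equiv> FA (idem_gens d)"

abbreviation N :: "nat \<Rightarrow> ('k::field, idem_gen) free_alg" where "N i \<equiv> word [Nonstarred i]"
abbreviation S :: "nat \<Rightarrow> ('k::field, idem_gen) free_alg" where "S i \<equiv> word [Starred i]"

lemma relators_subset: "relators d \<subseteq> B d"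
  by (auto simp: relators_def idem_gens_def intro!: FA_intros)

lemma ideal_rel_ideal: "ideal (rel_ideal d) (free_algebra (idem_gens d))"
  unfolding rel_ideal_def by (rule ring.genideal_ideal[OF ring_free_algebra relators_subset])

lemma relators_rel_ideal: "relators d \<subseteq> rel_ideal d"
  unfolding rel_ideal_def by (rule ring.genideal_self[OF ring_free_algebra relators_subset])

text \<open>Reduces a claim about all consequences of the relations to the relators; used for the
  exchange of stars and for the right action.\<close>

lemma rel_ideal_minimal:
  assumes "relators d \<subseteq> J" "J \<subseteq> B d" "fa.subspace J"
    and "\<And>p q. p \<in> J \<Longrightarrow> q \<in> B d \<Longrightarrow> p * q \<in> J" "\<And>p q. p \<in> J \<Longrightarrow> q \<in> B d \<Longrightarrow> q * p \<in> J"
  shows "rel_ideal d \<subseteq> J"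
proof -
  interpret ring "free_algebra (idem_gens d)" by (rule ring_free_algebra)
  have "ideal J (free_algebra (idem_gens d))"
  proof (rule idealI[OF ring_free_algebra])
    have "\<ominus>\<^bsub>free_algebra (idem_gens d)\<^esub> p = - p" if "p \<in> J" for p :: "('a, idem_gen) free_alg"
      using that assms(2) by (intro minus_equality) (auto intro: FA_intros)
    then show "subgroup J (add_monoid (free_algebra (idem_gens d)))"
      using assms(2,3) by (intro add.subgroupI)
        (auto simp: fa.subspace_neg fa.subspace_add a_inv_def dest: fa.subspace_0)
  qed (use assms in auto)
  then show ?thesis
    unfolding rel_ideal_def using assms(1) by (rule genideal_minimal)
qed

lemma rel_ideal_mult:
  assumes "p \<in> rel_ideal d" "q \<in> B d"
  shows "p * q \<in> rel_ideal d" "q * p \<in> rel_ideal d"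
  using assms ideal.I_l_closed[OF ideal_rel_ideal] ideal.I_r_closed[OF ideal_rel_ideal] by auto

lemma subspace_rel_ideal: "fa.subspace (rel_ideal d)"
proof (rule fa.subspaceI)
  interpret ideal "rel_ideal d" "free_algebra (idem_gens d)" by (rule ideal_rel_ideal)
  show "0 \<in> rel_ideal d" using additive_subgroup.zero_closed[OF additive_subgroup_axioms] by simp
  show "p + q \<in> rel_ideal d" if "p \<in> rel_ideal d" "q \<in> rel_ideal d" for p q
    using additive_subgroup.a_closed[OF additive_subgroup_axioms that] by simp
  \<comment> \<open>A ring ideal is closed under scalars because \<open>scl c p\<close> is the
    product of \<open>scl c 1\<close> and \<open>p\<close>.\<close>
  show "scl c p \<in> rel_ideal d" if "p \<in> rel_ideal d" for c p
    using rel_ideal_mult(2)[OF that FA_scl[OF FA_1], of c] by (simp flip: scl_mult_left)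
qed

definition proj :: "nat \<Rightarrow> ('k::field, idem_gen) free_alg \<Rightarrow> ('k, idem_gen) free_alg set" where
  "proj d p = rel_ideal d +>\<^bsub>free_algebra (idem_gens d)\<^esub> p"

lemma proj_eq: "proj d p = {i + p | i. i \<in> rel_ideal d}"
  by (auto simp: proj_def a_r_coset_def')

lemma proj_eq_iff: "proj d p = proj d q \<longleftrightarrow> p - q \<in> rel_ideal d"
proof
  have "p \<in> proj d p"
    using fa.subspace_0[OF subspace_rel_ideal] by (force simp: proj_eq)
  moreover assume "proj d p = proj d q"
  ultimately have "p \<in> proj d q" by blast
  then show "p - q \<in> rel_ideal d"
    by (auto simp: proj_eq)
next
  have *: "proj d p \<subseteq> proj d q" if "p - q \<in> rel_ideal d" for p q
  proof
    fix x assume "x \<in> proj d p"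
    then obtain i where "i \<in> rel_ideal d" "x = i + p" by (auto simp: proj_eq)
    then have "x = (i + (p - q)) + q" "i + (p - q) \<in> rel_ideal d"
      using that subspace_rel_ideal by (auto intro: fa.subspace_add)
    then show "x \<in> proj d q" unfolding proj_eq by blast
  qed
  assume "p - q \<in> rel_ideal d"
  moreover from this have "q - p \<in> rel_ideal d"
    using fa.subspace_neg[OF subspace_rel_ideal] by fastforce
  ultimately show "proj d p = proj d q"
    using * by blast
qed

lemma alg_A_sel:
  "carrier (alg_A d) = proj d ` B d"
  "one (alg_A d) = proj d 1"
  "zero (alg_A d) = proj d 0"
  "p \<in> B d \<Longrightarrow> q \<in> B d \<Longrightarrow> mult (alg_A d) (proj d p) (proj d q) = proj d (p * q)"
  "p \<in> B d \<Longrightarrow> q \<in> B d \<Longrightarrow> add (alg_A d) (proj d p) (proj d q) = proj d (p + q)"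
  "p \<in> B d \<Longrightarrow> smult (alg_A d) c (proj d p) = proj d (scl c p)"
proof -
  interpret ideal "rel_ideal d" "free_algebra (idem_gens d)" by (rule ideal_rel_ideal)
  note [simp] = alg_A_def quotient_algebra_def ring.defs module.defs FactRing_def
  show "carrier (alg_A d) = proj d ` B d"
    by (auto simp: A_RCOSETS_def' proj_def)
  show "one (alg_A d) = proj d 1" by (simp add: proj_def)
  show "zero (alg_A d) = proj d 0" by (simp add: proj_eq)
  show "p \<in> B d \<Longrightarrow> q \<in> B d \<Longrightarrow> mult (alg_A d) (proj d p) (proj d q) = proj d (p * q)"
    using rcoset_mult_add[of p q] by (simp add: proj_def)
  show "p \<in> B d \<Longrightarrow> q \<in> B d \<Longrightarrow> add (alg_A d) (proj d p) (proj d q) = proj d (p + q)"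
    using a_rcos_sum[of p q] by (simp add: proj_def)
  assume "p \<in> B d"
  \<comment> \<open>The scalar multiple of a coset is defined as a union over its representatives;
    all of them yield the same coset.\<close>
  have "proj d (scl c x) = proj d (scl c p)" if "x \<in> proj d p" for x
  proof -
    have "x - p \<in> rel_ideal d" using that by (auto simp: proj_eq)
    then show ?thesis
      using fa.subspace_scale[OF subspace_rel_ideal]
      by (simp add: proj_eq_iff flip: fa.scale_right_diff_distrib)
  qed
  moreover have "proj d p \<noteq> {}"
    using fa.subspace_0[OF subspace_rel_ideal] by (force simp: proj_eq)
  ultimately show "smult (alg_A d) c (proj d p) = proj d (scl c p)"
    by (simp flip: proj_def)
qed

lemma abelian_group_alg_A: "abelian_group (alg_A d)"
proof (rule abelian_groupI)
  fix x assume "x \<in> carrier (alg_A d)"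
  then obtain p where p: "p \<in> B d" "x = proj d p" by (auto simp: alg_A_sel)
  then have "proj d (- p) \<oplus>\<^bsub>alg_A d\<^esub> x = \<zero>\<^bsub>alg_A d\<^esub>" "proj d (- p) \<in> carrier (alg_A d)"
    by (auto simp: alg_A_sel FA_intros)
  then show "\<exists>y\<in>carrier (alg_A d). y \<oplus>\<^bsub>alg_A d\<^esub> x = \<zero>\<^bsub>alg_A d\<^esub>" by blast
qed (auto simp: alg_A_sel FA_intros algebra_simps)

lemma alg_A_minus:
  assumes "p \<in> B d" "q \<in> B d"
  shows "proj d p \<ominus>\<^bsub>alg_A d\<^esub> proj d q = proj d (p - q)"
proof -
  interpret abelian_group "alg_A d" by (rule abelian_group_alg_A)
  have "\<ominus>\<^bsub>alg_A d\<^esub> proj d q = proj d (- q)"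
    using assms by (intro minus_equality) (auto simp: alg_A_sel FA_intros)
  with assms show ?thesis
    by (simp add: a_minus_def alg_A_sel FA_intros)
qed

lemma lin_span_alg_A: "W \<subseteq> B d \<Longrightarrow> lin_span (alg_A d) (proj d ` W) = proj d ` fa.span W"
  by (rule lin_span_image[where V = "B d"])
    (auto simp: subspace_FA alg_A_sel abelian_group.axioms(1)[OF abelian_group_alg_A])

lemma gen_eq: "gen d g = proj d (word [g])"
  by (simp add: gen_def proj_def)

lemma gen_prod_eq: "set gs \<subseteq> idem_gens d \<Longrightarrow> gen_prod d gs = proj d (word gs)"
proof (induction gs)
  case (Cons g gs)
  then show ?case
    by (simp add: gen_prod_def gen_eq alg_A_sel FA_word flip: word_Cons)
qed (simp add: gen_prod_def alg_A_sel)

declare One_nat_def [simp del]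

lemma N_B: "i \<le> d \<Longrightarrow> N i \<in> B d" and S_B: "i \<le> d \<Longrightarrow> S i \<in> B d"
  by (simp_all add: FA_word idem_gens_def)

lemma lin_0 [simp]: "lin f 0 = 0"
  by (simp add: lin_def)

lemma lin_sum: "lin f (sum h T) = (\<Sum>i\<in>T. lin f (h i))"
  by (induction T rule: infinite_finite_induct) (simp_all add: lin_add)

lemma lin_uminus: "lin f (- p) = - lin f p"
  by (metis add.right_inverse lin_0 lin_add neg_eq_iff_add_eq_0)

lemma lin_diff: "lin f (p - q) = lin f p - lin f q"
  using lin_add[of f p "- q"] by (simp add: lin_uminus)

section \<open>The homomorphism from F to A\<close>

definition s_elt :: "nat \<Rightarrow> ('k::field, idem_gen) free_alg" where
  "s_elt i = N i - S i"

text \<open>The map F \<rightarrow> A before passing to cosets: its values are honest elements of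
  the free algebra on the idempotent symbols, and \<open>proj d\<close> is applied
  afterwards.\<close>

definition s_lift :: "('k::field, nat) free_alg \<Rightarrow> ('k, idem_gen) free_alg" where
  "s_lift = lin (\<lambda>xs. prod_list (map s_elt xs))"

lemma linear_s_lift: "Vector_Spaces.linear scl scl s_lift"
  unfolding s_lift_def by (rule linear_lin)

lemma s_lift_simps:
  "s_lift 0 = 0" "s_lift (p + q) = s_lift p + s_lift q" "s_lift (p - q) = s_lift p - s_lift q"
  "s_lift (- p) = - s_lift p" "s_lift (sum h T) = (\<Sum>i\<in>T. s_lift (h i))"
  "s_lift (scl c p) = scl c (s_lift p)"
  "s_lift (word xs) = prod_list (map s_elt xs)"
  by (simp_all add: s_lift_def lin_add lin_diff lin_uminus lin_sum lin_scale)

lemma s_lift_1: "s_lift 1 = 1"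
  using s_lift_simps(7)[of "[]"] by simp

lemma s_lift_mult: "s_lift (p * q) = s_lift p * s_lift q"
  by (rule mult_hom_on_words[OF linear_s_lift]) (simp add: s_lift_simps)

lemma s_elt_B: "i \<le> d \<Longrightarrow> s_elt i \<in> B d"
  by (simp add: s_elt_def FA_diff N_B S_B)

lemma s_lift_B:
  assumes "p \<in> FA {1..d}"
  shows "s_lift p \<in> B d"
proof -
  have "prod_list (map s_elt xs) \<in> B d" if "set xs \<subseteq> {1..d}" for xs
    using that by (induction xs) (simp_all add: FA_mult s_elt_B)
  then have "s_lift a \<in> fa.span (word ` {xs. set xs \<subseteq> idem_gens d})"
    if "a \<in> word ` {xs. set xs \<subseteq> {1..d}}" for a
    using that by (auto simp: s_lift_simps carrier_free_algebra)
  then show ?thesis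
    using assms unfolding carrier_free_algebra
    by (rule linear_mem_span[OF linear_s_lift, rotated])
qed

lemma proj_s_lift_in_s_maps: "(\<lambda>p. proj d (s_lift p)) \<in> s_maps d"
proof -
  have "(\<lambda>p. proj d (s_lift p)) \<in> ring_hom (free_algebra {1..d}) (alg_A d)"
    by (rule ring_hom_memI)
      (simp_all add: alg_A_sel s_lift_B imageI s_lift_simps s_lift_mult s_lift_1)
  then show ?thesis
    unfolding s_maps_def alg_hom_def
    by (simp add: alg_A_sel s_lift_B s_lift_simps gen_eq alg_A_minus N_B S_B s_elt_def)
qed

text \<open>Words in the s_i span F, so the prescribed values leave no choice on the carrier. Every
  claim about members of \<open>s_maps d\<close> becomes a claim about
  \<open>s_lift\<close>.\<close>

lemma s_maps_unique:
  fixes h :: "('k::field, nat) free_alg \<Rightarrow> ('k, idem_gen) free_alg set"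
  assumes h: "h \<in> s_maps d" and p: "p \<in> FA {1..d}"
  shows "h p = proj d (s_lift p)"
proof -
  let ?H = "\<lambda>p. proj d (s_lift p)"
  have H: "?H \<in> s_maps d"
    by (rule proj_s_lift_in_s_maps)
  have hom: "f \<in> ring_hom (free_algebra {1..d}) (alg_A d)"
    and scale: "q \<in> FA {1..d} \<Longrightarrow> f (scl c q) = c \<odot>\<^bsub>alg_A d\<^esub> f q"
    and gens: "i \<in> {1..d} \<Longrightarrow> f (word [i]) = gen d (Nonstarred i) \<ominus>\<^bsub>alg_A d\<^esub> gen d (Starred i)"
    if "f \<in> s_maps d" for f :: "('k, nat) free_alg \<Rightarrow> ('k, idem_gen) free_alg set" and c q i
    using that by (auto simp: s_maps_def alg_hom_def)
  have words: "h (word xs) = ?H (word xs)" if "set xs \<subseteq> {1..d}" for xs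
    using that
  proof (induction xs)
    case Nil
    then show ?case
      using ring_hom_one[OF hom[OF h]] by (simp add: alg_A_sel s_lift_1)
  next
    case (Cons i xs)
    have *: "f (word (i # xs)) =
        (gen d (Nonstarred i) \<ominus>\<^bsub>alg_A d\<^esub> gen d (Starred i)) \<otimes>\<^bsub>alg_A d\<^esub> f (word xs)" if "f \<in> s_maps d"
      for f :: "('k, nat) free_alg \<Rightarrow> ('k, idem_gen) free_alg set"
      using ring_hom_mult[OF hom[OF that], of "word [i]" "word xs"] gens[OF that, of i] Cons.prems
      by (simp add: FA_word word_Cons[of i xs])
    then show ?case
      using *[OF h] *[OF H] Cons by simp
  qed
  from p have "p \<in> fa.span (word ` {xs. set xs \<subseteq> {1..d}})"
    by (simp add: carrier_free_algebra)
  then have "p \<in> FA {1..d} \<and> h p = ?H p"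
  proof (induction rule: fa.span_induct_alt)
    case base
    \<comment> \<open>\<open>ring_hom\<close> says nothing about zero; the value there is obtained
      from compatibility with scalars.\<close>
    have "h 0 = h (scl 0 1)" by simp
    also have "\<dots> = proj d 0"
      by (subst scale[OF h])
        (use ring_hom_one[OF hom[OF h]] in \<open>simp_all add: alg_A_sel s_lift_1\<close>)
    finally show ?case by (simp add: s_lift_simps)
  next
    case (step c x y)
    then have x: "x \<in> FA {1..d}" "h x = ?H x" and y: "y \<in> FA {1..d}"
      using words step by (auto simp: FA_word)
    have "h (scl c x + y) = h (scl c x) \<oplus>\<^bsub>alg_A d\<^esub> h y"
      using ring_hom_add[OF hom[OF h], of "scl c x" y] x y by (simp add: FA_scl)
    also have "h (scl c x) = proj d (scl c (s_lift x))"
      using scale[OF h x(1)] x by (simp add: alg_A_sel s_lift_B)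
    finally show ?case
      using step x y by (simp add: alg_A_sel s_lift_simps s_lift_B FA_scl FA_add)
  qed
  then show ?thesis ..
qed

section \<open>The automorphism exchanging starred and nonstarred generators\<close>

definition swap :: "('k::field, idem_gen) free_alg \<Rightarrow> ('k, idem_gen) free_alg" where
  "swap = lin (\<lambda>xs. word (map swap_star xs))"

lemma linear_swap: "Vector_Spaces.linear scl scl swap"
  unfolding swap_def by (rule linear_lin)

lemma swap_simps:
  "swap (p + q) = swap p + swap q" "swap (p - q) = swap p - swap q"
  "swap (sum h T) = (\<Sum>i\<in>T. swap (h i))" "swap (scl c p) = scl c (swap p)"
  "swap (word xs) = word (map swap_star xs)" "swap 0 = 0"
  by (simp_all add: swap_def lin_add lin_diff lin_sum lin_scale)

lemma swap_1: "swap 1 = 1"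
  using swap_simps(5)[of "[]"] by simp

lemma swap_mult: "swap (p * q) = swap p * swap q"
  by (rule mult_hom_on_words[OF linear_swap]) (simp add: swap_simps flip: word_append)

lemma swap_star_swap_star [simp]: "swap_star (swap_star g) = g"
  by (cases g) simp_all

lemma swap_swap [simp]: "swap (swap p) = p"
  by (rule linear_eq_on_words[where S = "range word" and p = p and f = "\<lambda>p. swap (swap p)"])
    (simp_all add: linear_scl swap_simps in_span_words comp_def)

lemma index_swap_star [simp]: "index (swap_star g) = index g"
  by (cases g) simp_all

lemma starred_swap_star [simp]: "starred (swap_star g) \<longleftrightarrow> \<not> starred g"
  by (cases g) simp_all

lemma swap_B: "p \<in> B d \<Longrightarrow> swap p \<in> B d"
  unfolding carrier_free_algebra
  by (erule linear_mem_span[OF linear_swap])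
    (auto simp: swap_simps idem_gens_def subset_iff intro!: fa.span_base imageI)

text \<open>The elements whose image under \<open>swap\<close> lies in the ideal form an ideal
  themselves, and \<open>swap\<close> permutes the relators.\<close>

lemma swap_rel_ideal:
  fixes p :: "('k::field, idem_gen) free_alg"
  assumes "p \<in> rel_ideal d"
  shows "swap p \<in> rel_ideal d"
proof -
  let ?J = "{p :: ('k, idem_gen) free_alg. p \<in> B d \<and> swap p \<in> rel_ideal d}"
  have "rel_ideal d \<subseteq> ?J"
  proof (rule rel_ideal_minimal)
    have "swap r \<in> relators d" if "r \<in> relators d" for r :: "('k, idem_gen) free_alg"
    proof -
      consider i j where "i \<le> d" "j \<le> d" "r = N i * N j - (if i = j then N i else 0)"
        | i j where "i \<le> d" "j \<le> d" "r = S i * S j - (if i = j then S i else 0)"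
        | "r = 1 - (\<Sum>i\<le>d. N i)" | "r = 1 - (\<Sum>i\<le>d. S i)"
        using \<open>r \<in> relators d\<close> unfolding relators_def by blast
      then show ?thesis
      proof cases
        case (1 i j)
        then have "swap r = S i * S j - (if i = j then S i else 0)"
          by (simp add: swap_simps swap_mult)
        with 1 show ?thesis unfolding relators_def by blast
      next
        case (2 i j)
        then have "swap r = N i * N j - (if i = j then N i else 0)"
          by (simp add: swap_simps swap_mult)
        with 2 show ?thesis unfolding relators_def by blast
      next
        case 3
        then show ?thesis by (simp add: swap_simps swap_1 relators_def)
      next
        case 4
        then show ?thesis by (simp add: swap_simps swap_1 relators_def)
      qed
    qed
    then show "relators d \<subseteq> ?J"
      using relators_subset relators_rel_ideal by blast
    show "fa.subspace ?J"
      by (rule fa.subspaceI)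
        (simp_all add: swap_simps FA_add FA_scl fa.subspace_0[OF subspace_rel_ideal]
          fa.subspace_add[OF subspace_rel_ideal] fa.subspace_scale[OF subspace_rel_ideal])
  qed (simp_all add: swap_mult FA_mult rel_ideal_mult swap_B subset_iff)
  then show ?thesis using assms by blast
qed

text \<open>\<open>map_key\<close> precomposes the coefficients with the renaming, whereas
  \<open>swap\<close> renames the words. The two agree because the renaming is an
  involution.\<close>

lemma map_key_eq_swap: "Poly_Mapping.map_key (map_free_monoid swap_star) p = swap p"
proof -
  let ?f = "map_free_monoid swap_star"
  have inv: "?f (?f w) = w" for w
    by (cases w) (simp add: comp_def)
  then have inj: "inj ?f"
    by (metis injI)
  show ?thesis
  proof (rule linear_eq_on_words[where S = "range word" and p = p])
    show "Vector_Spaces.linear scl scl (Poly_Mapping.map_key ?f)"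
      by (rule linear_scl)
        (auto intro!: poly_mapping_eqI simp: map_key_plus[OF inj] map_key.rep_eq[OF inj])
    show "Poly_Mapping.map_key ?f (word xs) = swap (word xs)" for xs
      using map_key_single[OF inj, of "?f (FM xs)" 1] unfolding inv
      by (simp add: swap_simps) (simp add: word_def)
  qed (simp_all add: linear_swap in_span_words)
qed

lemma star_proj: "star (proj d p) = proj d (swap p)"
proof -
  have "star (proj d p) = swap ` proj d p"
    by (simp add: star_def map_key_eq_swap)
  also have "\<dots> = proj d (swap p)"
  proof
    show "swap ` proj d p \<subseteq> proj d (swap p)"
      using swap_rel_ideal by (auto simp: proj_eq swap_simps)
    show "proj d (swap p) \<subseteq> swap ` proj d p"
    proof
      fix x assume "x \<in> proj d (swap p)"
      then obtain i where "i \<in> rel_ideal d" "x = i + swap p" by (auto simp: proj_eq)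
      then have "x = swap (swap i + p)" "swap i + p \<in> proj d p"
        using swap_rel_ideal by (auto simp: proj_eq swap_simps)
      then show "x \<in> swap ` proj d p" by blast
    qed
  qed
  finally show ?thesis .
qed

section \<open>The right action on row vectors over the free algebra\<close>

text \<open>The preimage in $F$ of $s_i$; the case $i = 0$ comes from $\sum_i s_i = 0$.\<close>

definition s_word :: "nat \<Rightarrow> nat \<Rightarrow> ('k::field, nat) free_alg" where
  "s_word d i = (if i = 0 then - (\<Sum>l\<in>{1..d}. word [l]) else word [i])"

lemma sum_atMost_split_0: "(\<Sum>i\<le>d. h i) = h 0 + (\<Sum>i\<in>{1..d}. h i)" for h :: "nat \<Rightarrow> 'a::ab_group_add"
proof -
  have "{..d} = insert 0 {1..d}" by auto
  then show ?thesis by simp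
qed

lemma sum_s_word: "(\<Sum>i\<le>d. s_word d i) = 0"
proof -
  have "(\<Sum>i\<in>{1..d}. s_word d i) = (\<Sum>l\<in>{1..d}. word [l])"
    by (rule sum.cong) (auto simp: s_word_def)
  then show ?thesis
    by (simp add: sum_atMost_split_0) (simp add: s_word_def)
qed

text \<open>
  A row vector $v$ stands for $\sum_k v_k e_k$. From $e_k = s_k + e^*_k$ and the orthogonality of the
  $e^*_j$ one gets $v e^*_j = (v_j + \sum_l v_l s_l) e^*_j$, where $e^*_j = e_j - s_j \sum_k e_k$.
\<close>

definition coeff :: "nat \<Rightarrow> (nat \<Rightarrow> ('k::field, nat) free_alg) \<Rightarrow> nat \<Rightarrow> ('k, nat) free_alg" where
  "coeff d v j = v j + (\<Sum>l\<le>d. v l * s_word d l)"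

definition step :: "nat \<Rightarrow> (nat \<Rightarrow> ('k::field, nat) free_alg) \<Rightarrow> idem_gen \<Rightarrow> nat \<Rightarrow> ('k, nat) free_alg" where
  "step d v g k =
    (if d < k then 0 else
     case g of
       Nonstarred j \<Rightarrow> if k = j then v j else 0
     | Starred j \<Rightarrow> coeff d v j * ((if k = j then 1 else 0) - s_word d j))"

text \<open>Letters are consumed from the left, which makes this a right action.\<close>

definition act :: "nat \<Rightarrow> (nat \<Rightarrow> ('k::field, nat) free_alg) \<Rightarrow> ('k, idem_gen) free_alg \<Rightarrow> nat \<Rightarrow> ('k, nat) free_alg" where
  "act d v p k = lin (\<lambda>gs. foldl (step d) v gs k) p"

lemma act_word [simp]: "act d v (word gs) = foldl (step d) v gs"
  by (simp add: act_def fun_eq_iff)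

lemma act_1: "act d v 1 = v"
  using act_word[of d v "[]"] by simp

lemma act_right:
  "act d v 0 k = 0"
  "act d v (p + q) k = act d v p k + act d v q k" "act d v (p - q) k = act d v p k - act d v q k"
  "act d v (sum h T) k = (\<Sum>i\<in>T. act d v (h i) k)" "act d v (scl c p) k = scl c (act d v p k)"
  by (simp_all add: act_def lin_add lin_diff lin_sum lin_scale)

lemma step_add: "step d (\<lambda>k. u k + v k) g = (\<lambda>k. step d u g k + step d v g k)"
  by (auto simp: step_def coeff_def fun_eq_iff sum.distrib algebra_simps split: idem_gen.split)

lemma step_scl: "step d (\<lambda>k. scl c (v k)) g = (\<lambda>k. scl c (step d v g k))"
  by (auto simp: step_def coeff_def fun_eq_iff fa.scale_sum_right fa.scale_right_distrib
      scl_mult_left split: idem_gen.split)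

lemma foldl_step_add:
  "foldl (step d) (\<lambda>k. u k + v k) gs = (\<lambda>k. foldl (step d) u gs k + foldl (step d) v gs k)"
  by (induction gs arbitrary: u v) (simp_all add: step_add)

lemma foldl_step_scl: "foldl (step d) (\<lambda>k. scl c (v k)) gs = (\<lambda>k. scl c (foldl (step d) v gs k))"
  by (induction gs arbitrary: v) (simp_all add: step_scl)

lemma act_add: "act d (\<lambda>k. u k + v k) p k = act d u p k + act d v p k"
  by (rule linear_eq_on_words[where S = "range word" and p = p and f = "\<lambda>p. act d (\<lambda>k. u k + v k) p k"])
    (simp_all add: linear_scl act_right foldl_step_add in_span_words fa.scale_right_distrib)

lemma act_scl: "act d (\<lambda>k. scl c (v k)) p k = scl c (act d v p k)"
  by (rule linear_eq_on_words[where S = "range word" and p = p and f = "\<lambda>p. act d (\<lambda>k. scl c (v k)) p k"])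
    (simp_all add: linear_scl act_right foldl_step_scl in_span_words fa.scale_right_distrib
      fa.scale_left_commute)

text \<open>Linearity in the vector is essential here: \<open>act d v p\<close> is itself a linear
  combination of the vectors that come from the words of \<open>p\<close>.\<close>

lemma act_mult: "act d v (p * q) = act d (act d v p) q"
proof
  fix k
  have words: "act d v (word gs * q) k = act d (act d v (word gs)) q k" for gs
    by (rule linear_eq_on_words[where S = "range word" and p = q and f = "\<lambda>q. act d v (word gs * q) k"])
      (simp_all add: linear_scl act_right distrib_left scl_mult_right[symmetric] in_span_words
        word_append[symmetric])
  have "act d v (p + p') = (\<lambda>k. act d v p k + act d v p' k)" "act d v (scl c p) = (\<lambda>k. scl c (act d v p k))"
    for p p' c
    by (simp_all add: act_right fun_eq_iff)
  then show "act d v (p * q) k = act d (act d v p) q k"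
    by (intro linear_eq_on_words[where S = "range word" and p = p and f = "\<lambda>p. act d v (p * q) k"])
      (simp_all add: linear_scl act_right distrib_right scl_mult_left[symmetric] act_add act_scl
        in_span_words words del: act_word)
qed

lemma act_supported:
  assumes "\<And>k. k > d \<Longrightarrow> v k = 0" "k > d"
  shows "act d v p k = 0"
proof -
  have "foldl (step d) v gs k = 0" for gs
    using assms by (induction gs arbitrary: v) (simp_all add: step_def)
  then show ?thesis
    by (simp add: act_def lin_def)
qed

lemma act_zero: "act d (\<lambda>_. 0) p = (\<lambda>_. 0)"
  using act_scl[of d 0 "\<lambda>_. 0" p] by (simp add: fun_eq_iff)

text \<open>\<open>coeff d v j\<close> is the coordinate of v at e*_j, so this is the orthogonality
  of the starred idempotents. The row of e*_i has entries \<delta>_{il} - s_i; its j-th coefficient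
  is \<delta>_{ij} - s_i + s_i - s_i (\<Sum>l. s_l), and the last sum is 0.\<close>

lemma coeff_step_Starred:
  assumes "i \<le> d" "j \<le> d"
  shows "coeff d (step d v (Starred i)) j = (if i = j then coeff d v i else 0)"
proof -
  have "(\<Sum>l\<le>d. step d v (Starred i) l * s_word d l)
      = (\<Sum>l\<le>d. coeff d v i * (if l = i then s_word d l else 0) - coeff d v i * s_word d i * s_word d l)"
    by (rule sum.cong) (auto simp: step_def algebra_simps)
  also have "\<dots> = coeff d v i * s_word d i"
    using assms by (simp add: sum_subtractf sum_s_word flip: sum_distrib_left)
  finally show ?thesis
    using assms by (subst coeff_def) (auto simp: step_def algebra_simps)
qed

text \<open>This is the relation that the e*_j add up to 1. The sum of the s_j removes one
  correction term, and the other cancels the one inside \<open>coeff d v k\<close>.\<close>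

lemma sum_step_Starred:
  assumes "k \<le> d"
  shows "(\<Sum>j\<le>d. step d v (Starred j) k) = v k"
proof -
  let ?s = "\<Sum>l\<le>d. v l * s_word d l"
  have "(\<Sum>j\<le>d. step d v (Starred j) k)
      = (\<Sum>j\<le>d. (if j = k then coeff d v j else 0) - v j * s_word d j - ?s * s_word d j)"
    using assms by (intro sum.cong) (auto simp: step_def coeff_def algebra_simps)
  also have "\<dots> = coeff d v k - ?s"
    using assms by (simp add: sum_subtractf sum_s_word flip: sum_distrib_left)
  finally show ?thesis by (simp add: coeff_def)
qed

text \<open>The elements that annihilate all supported vectors form an ideal, so the relators
  suffice. The support condition matters for the relators with 1: the identity keeps entries beyond
  \<open>d\<close>, while the sum of the generators erases them.\<close>

lemma act_rel_ideal:
  fixes p :: "('k::field, idem_gen) free_alg"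
  assumes p: "p \<in> rel_ideal d" and v: "\<And>k. k > d \<Longrightarrow> v k = 0"
  shows "act d v p k = 0"
proof -
  \<comment> \<open>The quantifier over \<open>v\<close> gives closure under left multiplication by
    \<open>q\<close>, which replaces \<open>v\<close> by \<open>act d v q\<close>.\<close>
  let ?J = "{p :: ('k, idem_gen) free_alg. p \<in> B d \<and> (\<forall>v. (\<forall>k>d. v k = 0) \<longrightarrow> act d v p = (\<lambda>_. 0))}"
  have "rel_ideal d \<subseteq> ?J"
  proof (rule rel_ideal_minimal)
    have "act d v r = (\<lambda>_. 0)" if "r \<in> relators d" and v: "\<And>k. k > d \<Longrightarrow> v k = 0"
      for r :: "('k, idem_gen) free_alg" and v
    proof
      fix k
      consider i j where "i \<le> d" "j \<le> d" "r = N i * N j - (if i = j then N i else 0)"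
        | i j where "i \<le> d" "j \<le> d" "r = S i * S j - (if i = j then S i else 0)"
        | "r = 1 - (\<Sum>i\<le>d. N i)" | "r = 1 - (\<Sum>i\<le>d. S i)"
        using \<open>r \<in> relators d\<close> unfolding relators_def by blast
      then show "act d v r k = 0"
      proof cases
        case (1 i j)
        then show ?thesis
          by (auto simp: act_right act_mult step_def)
      next
        case (2 i j)
        have "step d (step d v (Starred i)) (Starred j) k = (if i = j then step d v (Starred i) k else 0)"
          using 2 coeff_step_Starred[of i d j v] by (subst step_def) (auto simp: step_def)
        with 2 show ?thesis
          by (auto simp: act_right act_mult)
      next
        case 3
        then show ?thesis
          using v[of k] by (cases "k \<le> d") (simp_all add: act_right act_1 step_def)
      next
        case 4
        then show ?thesis
          using v[of k] sum_step_Starred[of k d v]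
          by (cases "k \<le> d") (simp_all add: act_right act_1, simp_all add: step_def)
      qed
    qed
    then show "relators d \<subseteq> ?J"
      using relators_subset by blast
    show "fa.subspace ?J"
      by (rule fa.subspaceI) (simp_all add: FA_add FA_scl act_right fun_eq_iff)
  next
    fix p q :: "('k, idem_gen) free_alg" assume p: "p \<in> ?J" and q: "q \<in> B d"
    have "act d v (p * q) = (\<lambda>_. 0)" if "\<forall>k>d. v k = 0" for v
    proof -
      have "act d v p = (\<lambda>_. 0)" using p that by blast
      then show ?thesis by (simp add: act_mult act_zero)
    qed
    then show "p * q \<in> ?J" using p q by (simp add: FA_mult)
    have "act d v (q * p) = (\<lambda>_. 0)" if "\<forall>k>d. v k = 0" for v
    proof -
      have "\<forall>k>d. act d v q k = 0" using that by (simp add: act_supported)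
      then show ?thesis using p by (simp add: act_mult)
    qed
    then show "q * p \<in> ?J" using p q by (simp add: FA_mult)
  qed auto
  then have "p \<in> ?J" using p by blast
  then show ?thesis using v by simp
qed

text \<open>The row of the element a of F, written as a times the sum of the e_k. Since the s_l add
  up to 0, its starred coordinates are all equal to a as well.\<close>

definition const_vec :: "nat \<Rightarrow> ('k::field, nat) free_alg \<Rightarrow> nat \<Rightarrow> ('k, nat) free_alg" where
  "const_vec d a k = (if k \<le> d then a else 0)"

lemma coeff_const_vec: "j \<le> d \<Longrightarrow> coeff d (const_vec d a) j = a"
  by (simp add: coeff_def const_vec_def sum_s_word flip: sum_distrib_left)

text \<open>The rows of a e_i and a e*_i have entries a \<delta>_{ik} and a (\<delta>_{ik} - s_i);
  in their difference the dependence on k disappears.\<close>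

lemma act_s_elt:
  assumes "i \<in> {1..d}"
  shows "act d (const_vec d a) (s_elt i) = const_vec d (a * word [i])"
  using assms
  by (auto simp: fun_eq_iff s_elt_def act_right step_def coeff_const_vec algebra_simps s_word_def)
    (auto simp: const_vec_def)

lemma act_s_lift:
  assumes "p \<in> FA {1..d}"
  shows "act d (const_vec d a) (s_lift p) = const_vec d (a * p)"
proof
  fix k
  have words: "act d (const_vec d a) (prod_list (map s_elt xs)) = const_vec d (a * word xs)"
    if "set xs \<subseteq> {1..d}" for xs
    using that
  proof (induction xs arbitrary: a)
    case (Cons x xs)
    then show ?case
      unfolding word_Cons[of x xs] by (simp add: act_mult act_s_elt mult.assoc)
  qed (simp add: act_1)
  show "act d (const_vec d a) (s_lift p) k = const_vec d (a * p) k"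
    by (rule linear_eq_on_words[where S = "word ` {xs. set xs \<subseteq> {1..d}}" and p = p
          and f = "\<lambda>p. act d (const_vec d a) (s_lift p) k"])
     (use assms in \<open>auto intro!: linear_scl simp: s_lift_simps act_right const_vec_def distrib_left
        scl_mult_right carrier_free_algebra words\<close>)
qed

lemma s_lift_injective:
  assumes "p \<in> FA {1..d}" "q \<in> FA {1..d}" "proj d (s_lift p) = proj d (s_lift q)"
  shows "p = q"
proof -
  have "s_lift (p - q) \<in> rel_ideal d"
    using assms by (simp add: proj_eq_iff s_lift_simps)
  then have "act d (const_vec d 1) (s_lift (p - q)) 0 = 0"
    by (rule act_rel_ideal) (simp add: const_vec_def)
  then show ?thesis
    using assms by (simp add: act_s_lift FA_diff) (simp add: const_vec_def)
qed

section \<open>Nonrepeating words modulo the relations\<close>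

abbreviation F_comp :: "nat \<Rightarrow> nat \<Rightarrow> ('k::field, nat) free_alg set" where
  "F_comp d n \<equiv> fa.span (word ` {xs. set xs \<subseteq> {1..d} \<and> length xs = n})"

lemma F_comp_subset: "F_comp d n \<subseteq> FA {1..d}"
  unfolding carrier_free_algebra by (rule fa.span_mono) auto

lemma F_comp_mult: "p \<in> F_comp d m \<Longrightarrow> q \<in> F_comp d n \<Longrightarrow> p * q \<in> F_comp d (m + n)"
  by (erule (1) span_mult) (auto intro!: fa.span_base imageI simp flip: word_append)

lemma one_F_comp: "1 \<in> F_comp d 0"
  by (rule fa.span_base) (simp add: image_iff)

lemma word_F_comp: "i \<in> {1..d} \<Longrightarrow> word [i] \<in> F_comp d 1"
  by (rule fa.span_base) (auto simp: One_nat_def)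

lemma s_word_F_comp: "i \<le> d \<Longrightarrow> s_word d i \<in> F_comp d 1"
  by (auto simp: s_word_def intro!: fa.span_neg fa.span_sum word_F_comp)

lemma lookup_F_comp:
  assumes "p \<in> F_comp d n" "Poly_Mapping.lookup p w \<noteq> 0"
  shows "length (letters w) = n"
  using assms
proof (induction rule: fa.span_induct_alt)
  case (step c x y)
  then show ?case
    by (auto simp: lookup_add word_def lookup_single when_def split: if_splits)
qed simp

lemma F_comp_disjoint:
  assumes "p \<in> F_comp d m" "p \<in> F_comp d n" "m \<noteq> n"
  shows "p = 0"
  using lookup_F_comp[OF assms(1)] lookup_F_comp[OF assms(2)] assms(3)
  by (intro poly_mapping_eqI) (metis lookup_zero)

text \<open>Right division by the letter \<open>i\<close>. It recovers the coefficient of that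
  letter and so witnesses that the letters are independent over F with coefficients on the
  left.\<close>

definition strip_last :: "nat \<Rightarrow> ('k::field, nat) free_alg \<Rightarrow> ('k, nat) free_alg" where
  "strip_last i = lin (\<lambda>xs. if xs \<noteq> [] \<and> last xs = i then word (butlast xs) else 0)"

lemma strip_last_mult_word: "strip_last i (q * word [j]) = (if i = j then q else 0)"
  by (rule linear_eq_on_words[where S = "range word" and p = q and f = "\<lambda>q. strip_last i (q * word [j])"])
    (simp_all add: linear_scl strip_last_def lin_add lin_scale distrib_right in_span_words
      scl_mult_left[symmetric] word_append[symmetric])

text \<open>Eliminating s_0 turns the hypothesis into a relation among the letters 1 to d with
  coefficients q_j - q_0, which must vanish.\<close>

lemma s_word_relation:
  assumes "(\<Sum>j\<le>d. q j * s_word d j) = 0" "i \<le> d"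
  shows "q i = q 0"
proof (cases "i = 0")
  case False
  then have i: "i \<in> {1..d}" using assms by simp
  have "(\<Sum>j\<in>{1..d}. q j * s_word d j) = (\<Sum>j\<in>{1..d}. q j * word [j])"
    by (rule sum.cong) (simp_all add: s_word_def)
  then have "(\<Sum>j\<in>{1..d}. (q j - q 0) * word [j]) = 0"
    using assms(1) by (simp add: sum_atMost_split_0)
      (simp add: s_word_def sum_distrib_left left_diff_distrib sum_subtractf)
  then have "strip_last i (\<Sum>j\<in>{1..d}. (q j - q 0) * word [j]) = 0"
    by (simp add: strip_last_def)
  also have "strip_last i (\<Sum>j\<in>{1..d}. (q j - q 0) * word [j])
      = (\<Sum>j\<in>{1..d}. strip_last i ((q j - q 0) * word [j]))"
    by (simp add: strip_last_def lin_sum)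
  also have "\<dots> = q i - q 0"
    using i by (simp add: strip_last_mult_word)
  finally show ?thesis by simp
qed simp

section \<open>Nonrepeating words as multiples of their last generator\<close>

abbreviation generator :: "bool \<Rightarrow> nat \<Rightarrow> idem_gen" where
  "generator b j \<equiv> if b then Starred j else Nonstarred j"

lemmas rel_ideal_0 = fa.subspace_0[OF subspace_rel_ideal]
  and rel_ideal_add = fa.subspace_add[OF subspace_rel_ideal]
  and rel_ideal_diff = fa.subspace_diff[OF subspace_rel_ideal]
  and rel_ideal_uminus = fa.subspace_neg[OF subspace_rel_ideal]
  and rel_ideal_scl = fa.subspace_scale[OF subspace_rel_ideal]

lemma sum_generators: "1 - (\<Sum>j\<le>d. word [generator b j]) \<in> rel_ideal d"
  using relators_rel_ideal[of d] by (cases b) (auto simp: relators_def)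

lemma sum_s_elt: "(\<Sum>i\<le>d. s_elt i :: ('k::field, idem_gen) free_alg) \<in> rel_ideal d"
proof -
  have "(\<Sum>i\<le>d. s_elt i :: ('k, idem_gen) free_alg) = (1 - (\<Sum>j\<le>d. word [generator True j])) - (1 - (\<Sum>j\<le>d. word [generator False j]))"
    by (simp add: s_elt_def sum_subtractf)
  then show ?thesis
    using rel_ideal_diff[OF sum_generators[where b = True] sum_generators[where b = False]] by simp
qed

text \<open>For \<open>i = 0\<close> this is only a congruence: it compares the two decompositions
  of 1.\<close>

lemma s_lift_s_word:
  assumes "i \<le> d"
  shows "s_lift (s_word d i) - s_elt i \<in> (rel_ideal d :: ('k::field, idem_gen) free_alg set)"
proof (cases "i = 0")
  case True
  have "s_lift (s_word d i) - s_elt i = - (\<Sum>i\<le>d. s_elt i :: ('k, idem_gen) free_alg)"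
    by (simp add: True s_word_def s_lift_simps sum_atMost_split_0)
  then show ?thesis
    using rel_ideal_uminus[OF sum_s_elt[of d]] by simp
qed (simp add: s_word_def s_lift_simps rel_ideal_0)

lemma orthogonal:
  assumes "i \<le> d" "j \<le> d" "i \<noteq> j"
  shows "word [generator b i] * word [generator b j] \<in> (rel_ideal d :: ('k::field, idem_gen) free_alg set)"
proof -
  let ?r = "word [generator b i] * word [generator b j] :: ('k, idem_gen) free_alg"
  have "?r \<in> relators d"
  proof (cases b)
    case True
    then have "\<exists>i' j'. ?r = S i' * S j' - (if i' = j' then S i' else 0) \<and> i' \<le> d \<and> j' \<le> d"
      using assms by (intro exI[of _ i] exI[of _ j]) simp
    then show ?thesis unfolding relators_def by (intro UnI1 UnI2 CollectI)
  next
    case False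
    then have "\<exists>i' j'. ?r = N i' * N j' - (if i' = j' then N i' else 0) \<and> i' \<le> d \<and> j' \<le> d"
      using assms by (intro exI[of _ i] exI[of _ j]) simp
    then show ?thesis unfolding relators_def by (intro UnI1 CollectI)
  qed
  then show ?thesis using relators_rel_ideal by blast
qed

text \<open>One of the two terms of s_i is orthogonal to the generator on its right. The surviving
  term carries the sign it has in s_i, hence the dependence on \<open>b\<close>.\<close>

lemma s_elt_mult:
  assumes "i \<le> d" "j \<le> d" "i \<noteq> j"
  shows "s_elt i * word [generator b j] -
    (if b then 1 else - 1) * (word [generator (\<not> b) i] * word [generator b j])
      \<in> (rel_ideal d :: ('k::field, idem_gen) free_alg set)"
    (is "_ * ?h - _ * (?g * _) \<in> _")
proof (cases b)
  case True
  then have "s_elt i * ?h - (if b then 1 else - 1) * (?g * ?h) = - (word [generator b i] * ?h)"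
    by (simp add: s_elt_def algebra_simps)
  then show ?thesis
    using rel_ideal_uminus[OF orthogonal[OF assms, of b]] by (simp only:)
next
  case False
  then have "s_elt i * ?h - (if b then 1 else - 1) * (?g * ?h) = word [generator b i] * ?h"
    by (simp add: s_elt_def algebra_simps)
  then show ?thesis
    using orthogonal[OF assms, of b] by (simp only:)
qed

definition NR_words :: "nat \<Rightarrow> nat \<Rightarrow> idem_gen \<Rightarrow> idem_gen list set" where
  "NR_words d n g = {gs. is_word d gs \<and> nonrepeating gs \<and> length gs = n \<and> last gs = g}"

lemma gen_cases: obtains b j where "g = generator b j"
proof (cases g)
  case (Nonstarred i)
  then show ?thesis using that[of False i] by simp
next
  case (Starred i)
  then show ?thesis using that[of True i] by simp
qed

lemma word_B: "set gs \<subseteq> idem_gens d \<Longrightarrow> word gs \<in> B d"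
  by (rule FA_word)

text \<open>Letters are converted from the right end: each one, standing before a generator of the
  other kind and of different index, may be replaced by s_i up to sign. The factors s_i collect on
  the left and only the last generator remains.\<close>

lemma NR_word_cong:
  assumes "gs \<in> NR_words d (Suc n) g"
  shows "\<exists>f\<in>F_comp d n. word gs - s_lift f * word [g] \<in> (rel_ideal d :: ('k::field, idem_gen) free_alg set)"
  using assms
proof (induction n arbitrary: gs)
  case 0
  then have "gs = [g]"
    by (cases gs) (auto simp: NR_words_def)
  then show ?case
    using one_F_comp rel_ideal_0 by (intro bexI[of _ 1]) (auto simp: s_lift_1)
next
  case (Suc n)
  then obtain x h gs' where gs: "gs = x # h # gs'"
    by (cases gs; cases "tl gs") (auto simp: NR_words_def)
  have tl: "h # gs' \<in> NR_words d (Suc n) g"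
    and xh: "starred x \<noteq> starred h" "index x \<noteq> index h" "index x \<le> d" "index h \<le> d"
    and gs': "set gs' \<subseteq> idem_gens d"
    using Suc.prems by (auto simp: gs NR_words_def is_word_def nonrepeating_def idem_gens_def)
  from Suc.IH[OF tl] obtain f :: "('k, nat) free_alg" where f: "f \<in> F_comp d n"
    "word (h # gs') - s_lift f * word [g] \<in> rel_ideal d" by blast
  obtain b j where h: "h = generator b j" by (rule gen_cases)
  obtain i where x: "x = generator (\<not> b) i"
    using xh(1) by (cases x) (auto simp: h split: if_splits)
  have ij: "i \<le> d" "j \<le> d" "i \<noteq> j" using xh by (auto simp: h x split: if_splits)
  \<comment> \<open>The sign comes from \<open>s_elt_mult\<close>; \<open>s_word\<close> is used
    because the index \<open>i\<close> may be 0.\<close>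
  define t :: "('k, nat) free_alg" where "t = (if b then s_word d i else - s_word d i)"
  have t: "t \<in> F_comp d 1"
    using ij(1) by (simp add: t_def fa.span_neg s_word_F_comp)
  \<comment> \<open>The sign is its own inverse, so multiplying \<open>s_elt_mult\<close> by it
    moves it to the other term.\<close>
  let ?e = "if b then 1 else - 1 :: ('k, idem_gen) free_alg"
  have sign: "?e * p \<in> rel_ideal d" if "p \<in> rel_ideal d" for p
    using that by (simp add: rel_ideal_uminus)
  have "(s_lift (s_word d i) - s_elt i) * word [h] \<in> (rel_ideal d :: ('k, idem_gen) free_alg set)"
    using xh ij by (intro rel_ideal_mult s_lift_s_word word_B) (simp_all add: idem_gens_def)
  then have "?e * ((s_lift (s_word d i) - s_elt i) * word [h]) \<in> rel_ideal d"
    by (rule sign)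
  also have "?e * ((s_lift (s_word d i) - s_elt i) * word [h]) = s_lift t * word [h] - ?e * (s_elt i * word [h])"
    by (simp add: t_def s_lift_simps left_diff_distrib)
  finally have 1: "s_lift t * word [h] - ?e * (s_elt i * word [h]) \<in> rel_ideal d" .
  have "?e * (s_elt i * word [h] - ?e * (word [x] * word [h])) \<in> rel_ideal d"
    unfolding h x by (rule sign[OF s_elt_mult[OF ij]])
  also have "?e * (s_elt i * word [h] - ?e * (word [x] * word [h])) = ?e * (s_elt i * word [h]) - word [x] * word [h]"
    by simp
  finally have 2: "?e * (s_elt i * word [h]) - word [x] * word [h] \<in> rel_ideal d" .
  have "s_lift t * word [h] - word [x] * word [h] \<in> rel_ideal d"
    using rel_ideal_add[OF 1 2] by (simp only: diff_add_eq add_diff_eq diff_add_cancel add_diff_cancel_right')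
  from rel_ideal_mult(1)[OF rel_ideal_uminus[OF this], of "word gs'"]
  have 3: "(word [x] * word [h] - s_lift t * word [h]) * word gs' \<in> rel_ideal d"
    using gs' by (simp add: word_B)
  have 4: "s_lift t * (word (h # gs') - s_lift f * word [g]) \<in> rel_ideal d"
    using t F_comp_subset by (intro rel_ideal_mult(2)[OF f(2)] s_lift_B) blast
  have 5: "word gs - s_lift (t * f) * word [g] =
      (word [x] * word [h] - s_lift t * word [h]) * word gs' +
      s_lift t * (word (h # gs') - s_lift f * word [g])"
    unfolding gs word_Cons[of x "h # gs'"] word_Cons[of h gs']
    by (simp add: s_lift_mult algebra_simps)
  have "word gs - s_lift (t * f) * word [g] \<in> rel_ideal d"
    unfolding 5 by (rule rel_ideal_add[OF 3 4])
  moreover have "t * f \<in> F_comp d (Suc n)"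
    using F_comp_mult[OF t f(1)] by (simp only: plus_1_eq_Suc)
  ultimately show ?case by blast
qed

lemma NR_words_snoc:
  assumes "gs \<in> NR_words d (Suc n) (generator (\<not> b) i)" "i \<le> d" "j \<le> d" "i \<noteq> j"
  shows "gs @ [generator b j] \<in> NR_words d (Suc (Suc n)) (generator b j)"
  using assms
  by (auto simp: NR_words_def is_word_def nonrepeating_def successively_append_iff idem_gens_def)

text \<open>The converse of the previous rewriting. The last factor s_i of \<open>f\<close> turns
  the final generator into a product of two generators of opposite kinds; the induction hypothesis,
  for the other value of \<open>b\<close>, handles what stands before.\<close>

lemma s_lift_mult_generator:
  fixes f :: "('k::field, nat) free_alg"
  assumes "f \<in> F_comp d n" "j \<le> d"
  shows "s_lift f * word [generator b j] \<in> fa.span (word ` NR_words d (Suc n) (generator b j) \<union> rel_ideal d)"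
  using assms
proof (induction n arbitrary: f b j)
  case 0
  have "word [generator b j] \<in> word ` NR_words d (Suc 0) (generator b j)"
    using \<open>j \<le> d\<close> by (auto simp: NR_words_def is_word_def nonrepeating_def idem_gens_def)
  then have *: "s_lift (word []) * word [generator b j] \<in>
      fa.span (word ` NR_words d (Suc 0) (generator b j) \<union> rel_ideal d)"
    by (intro fa.span_base UnI1) (simp only: s_lift_1 word_Nil mult_1)
  show ?case
    using 0(1)
    by (rule linear_mem_span[rotated, where f = "\<lambda>f. s_lift f * word [generator b j]"])
      (use * in \<open>auto intro!: linear_scl simp: s_lift_simps distrib_right scl_mult_left\<close>)
next
  case (Suc n)
  let ?Z = "fa.span (word ` NR_words d (Suc (Suc n)) (generator b j) \<union> rel_ideal d)"
  have gB: "word [generator b j] \<in> B d"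
    using Suc.prems by (simp add: N_B S_B)
  have off: "s_lift f * (s_elt i * word [generator b j]) \<in> ?Z"
    if f: "f \<in> F_comp d n" and i: "i \<le> d" "i \<noteq> j" for f :: "('k, nat) free_alg" and i
  proof -
    let ?g = "word [generator (\<not> b) i]" and ?h = "word [generator b j]"
    have fB: "s_lift f \<in> B d" using f F_comp_subset s_lift_B by blast
    have "s_lift f * ?g * ?h \<in> ?Z"
      by (rule linear_mem_span[OF linear_mult_left Suc.IH[OF f i(1), of "\<not> b"]])
        (use NR_words_snoc[of _ d n b i j] i Suc.prems gB in
          \<open>auto intro!: fa.span_base rel_ideal_mult(1) simp flip: word_append\<close>)
    then have 1: "(if b then 1 else - 1) * (s_lift f * ?g * ?h) \<in> ?Z"
      using fa.span_neg by (cases b) auto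
    have 2: "s_lift f * (s_elt i * ?h - (if b then 1 else - 1) * (?g * ?h)) \<in> ?Z"
      using rel_ideal_mult(2)[OF s_elt_mult[OF i(1) Suc.prems(2) i(2), of b] fB]
      by (intro fa.span_base) simp
    have 3: "s_lift f * (s_elt i * ?h) = (if b then 1 else - 1) * (s_lift f * ?g * ?h) +
        s_lift f * (s_elt i * ?h - (if b then 1 else - 1) * (?g * ?h))"
      by (cases b) (simp_all add: algebra_simps)
    show ?thesis
      unfolding 3 by (rule fa.span_add[OF 1 2])
  qed
  \<comment> \<open>For \<open>i = j\<close> the product s_j e_j is not covered by
    \<open>s_elt_mult\<close>. Since the s_k sum to 0 modulo the relations, s_j is traded for the
    remaining s_k.\<close>
  have all: "s_lift f * (s_elt i * word [generator b j]) \<in> ?Z"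
    if f: "f \<in> F_comp d n" and i: "i \<le> d" for f :: "('k, nat) free_alg" and i
  proof (cases "i = j")
    case True
    let ?h = "word [generator b j]"
    have fB: "s_lift f \<in> B d" using f F_comp_subset s_lift_B by blast
    have 1: "s_lift f * ((\<Sum>k\<le>d. s_elt k) * ?h) \<in> ?Z"
      by (intro fa.span_base UnI2 rel_ideal_mult sum_s_elt gB fB)
    have 2: "(\<Sum>k\<in>{..d} - {j}. s_lift f * (s_elt k * ?h)) \<in> ?Z"
      using off[OF f] by (intro fa.span_sum) auto
    have 3: "s_lift f * (s_elt j * ?h) =
        s_lift f * ((\<Sum>k\<le>d. s_elt k) * ?h) - (\<Sum>k\<in>{..d} - {j}. s_lift f * (s_elt k * ?h))"
      using Suc.prems by (subst sum.remove[of _ j])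
        (simp_all add: distrib_right distrib_left sum_distrib_left sum_distrib_right)
    show ?thesis
      unfolding True 3 by (rule fa.span_diff[OF 1 2])
  qed (use off f i in auto)
  show ?case
    using Suc.prems(1)
  proof (rule linear_mem_span[rotated, where f = "\<lambda>f. s_lift f * word [generator b j]"])
    fix a :: "('k, nat) free_alg" assume "a \<in> word ` {xs. set xs \<subseteq> {1..d} \<and> length xs = Suc n}"
    then obtain xs where a: "a = word xs" and xs: "set xs \<subseteq> {1..d}" "length xs = Suc n" by blast
    then obtain ys i where xs': "xs = ys @ [i]" by (metis length_Suc_conv_rev)
    have "word ys \<in> F_comp d n" using xs xs' by (intro fa.span_base) auto
    from all[OF this, of i] xs xs' show "s_lift a * word [generator b j] \<in> ?Z"
      by (simp add: a s_lift_simps mult.assoc)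
  qed (auto intro!: linear_scl simp: s_lift_simps distrib_right scl_mult_left)
qed

section \<open>The spaces A_{n+1} and A*_{n+1} and their intersection\<close>

definition NR_span :: "nat \<Rightarrow> nat \<Rightarrow> bool \<Rightarrow> ('k::field, idem_gen) free_alg set" where
  "NR_span d n b = fa.span (word ` (\<Union>j\<le>d. NR_words d (Suc n) (generator b j)))"

lemma NR_words_Union:
  "(\<Union>j\<le>d. NR_words d (Suc n) (generator b j)) =
    {gs. is_word d gs \<and> nonrepeating gs \<and> length gs = n + 1 \<and> starred (last gs) = b}"
proof -
  have last: "(\<exists>j\<le>d. last gs = generator b j) \<longleftrightarrow> starred (last gs) = b" if "is_word d gs" for gs
  proof -
    have "last gs \<in> idem_gens d" using that by (auto simp: is_word_def)
    then show ?thesis by (cases "last gs") (auto simp: idem_gens_def)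
  qed
  have mem: "gs \<in> (\<Union>j\<le>d. NR_words d (Suc n) (generator b j)) \<longleftrightarrow>
      is_word d gs \<and> nonrepeating gs \<and> length gs = n + 1 \<and> (\<exists>j\<le>d. last gs = generator b j)" for gs
    unfolding NR_words_def by auto
  show ?thesis
    by (rule Set.set_eqI) (simp only: mem last mem_Collect_eq cong: conj_cong)
qed

lemma NR_space_eq: "NR_space d (n + 1) = (proj d ` NR_span d n False :: ('k::field, idem_gen) free_alg set set)"
proof -
  let ?W = "{gs. is_word d gs \<and> nonrepeating gs \<and> length gs = n + 1 \<and> \<not> starred (last gs)}"
  have "gen_prod d ` ?W = (proj d ` word ` ?W :: ('k, idem_gen) free_alg set set)"
    unfolding image_image by (intro image_cong) (auto simp: is_word_def gen_prod_eq)
  moreover have "word ` ?W \<subseteq> (B d :: ('k, idem_gen) free_alg set)"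
    by (auto simp: is_word_def word_B)
  ultimately show ?thesis
    unfolding NR_space_def NR_span_def NR_words_Union simp_thms by (simp only: lin_span_alg_A)
qed

lemma swap_NR_span: "swap ` NR_span d n False = (NR_span d n True :: ('k::field, idem_gen) free_alg set)"
proof -
  interpret Vector_Spaces.linear scl scl "swap :: ('k, idem_gen) free_alg \<Rightarrow> _" by (rule linear_swap)
  let ?W = "\<lambda>b. {gs. is_word d gs \<and> nonrepeating gs \<and> length gs = n + 1 \<and> starred (last gs) = b}"
  have *: "map swap_star gs \<in> ?W (\<not> b)" if "gs \<in> ?W b" for gs b
    using that
    by (auto simp: is_word_def nonrepeating_def successively_map last_map idem_gens_def)
  have "map swap_star ` ?W False = ?W True"
  proof
    show "?W True \<subseteq> map swap_star ` ?W False"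
    proof
      fix gs assume "gs \<in> ?W True"
      then have "map swap_star gs \<in> ?W False" using *[of gs True] by simp
      then show "gs \<in> map swap_star ` ?W False"
        by (intro image_eqI[where x = "map swap_star gs"]) (simp_all add: comp_def)
    qed
  qed (use *[of _ False] in auto)
  then have "swap ` word ` ?W False = (word ` ?W True :: ('k, idem_gen) free_alg set)"
    by (simp add: image_image swap_simps flip: image_image[of word "map swap_star"])
  then show ?thesis
    unfolding NR_span_def NR_words_Union by (simp flip: span_image)
qed

lemma NR_space_star_eq: "NR_space_star d (n + 1) = proj d ` NR_span d n True"
  unfolding NR_space_star_def NR_space_eq swap_NR_span[symmetric] by (simp add: image_image star_proj)

text \<open>Grouping the words by their last generator yields coordinates. They have degree
  \<open>n\<close> because all but the last of the \<open>n + 1\<close> letters are converted. Only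
  existence is asserted; comparison of coordinates is left to the action.\<close>

lemma NR_span_cong:
  fixes x :: "('k::field, idem_gen) free_alg"
  assumes "x \<in> NR_span d n b"
  obtains f :: "nat \<Rightarrow> ('k, nat) free_alg" where "\<And>j. f j \<in> F_comp d n"
    "x - (\<Sum>j\<le>d. s_lift (f j) * word [generator b j]) \<in> rel_ideal d"
proof -
  have "\<exists>f. (\<forall>j. f j \<in> F_comp d n) \<and>
      x - (\<Sum>j\<le>d. s_lift (f j) * word [generator b j]) \<in> rel_ideal d"
    using assms unfolding NR_span_def
  proof (induction rule: fa.span_induct_alt)
    case base
    show ?case
      by (rule exI[of _ "\<lambda>_. 0"]) (simp add: fa.span_zero s_lift_simps rel_ideal_0)
  next
    case (step c x y)
    then obtain f where f: "\<And>j. f j \<in> F_comp d n"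
      "y - (\<Sum>j\<le>d. s_lift (f j) * word [generator b j]) \<in> rel_ideal d" by blast
    from step obtain gs i where i: "i \<le> d" and gs: "gs \<in> NR_words d (Suc n) (generator b i)" "x = word gs"
      by auto
    from NR_word_cong[OF gs(1)] obtain q where q: "q \<in> F_comp d n"
      "x - s_lift q * word [generator b i] \<in> rel_ideal d" unfolding gs(2) by blast
    let ?f = "f(i := scl c q + f i)"
    have "(\<Sum>j\<le>d. s_lift (?f j) * word [generator b j])
        = (\<Sum>j\<le>d. (if j = i then scl c (s_lift q * word [generator b i]) else 0) + s_lift (f j) * word [generator b j])"
      by (intro sum.cong) (auto simp: s_lift_simps distrib_right scl_mult_left)
    also have "\<dots> = scl c (s_lift q * word [generator b i]) + (\<Sum>j\<le>d. s_lift (f j) * word [generator b j])"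
      using i by (simp add: sum.distrib)
    finally have "scl c x + y - (\<Sum>j\<le>d. s_lift (?f j) * word [generator b j])
        = scl c (x - s_lift q * word [generator b i]) + (y - (\<Sum>j\<le>d. s_lift (f j) * word [generator b j]))"
      by (simp only: fa.scale_right_diff_distrib add_diff_add)
    also have "\<dots> \<in> rel_ideal d"
      by (intro rel_ideal_add rel_ideal_scl q f)
    finally show ?case
      using f q by (intro exI[of _ ?f]) (simp add: fa.span_add fa.span_scale)
  qed
  then show thesis using that by blast
qed

text \<open>Multiply on the right by 1, written as the sum of the generators of the kind chosen by
  \<open>b\<close>. Both choices together put the image of F_n into the intersection.\<close>

lemma s_lift_in_NR_span:
  fixes f :: "('k::field, nat) free_alg"
  assumes "f \<in> F_comp d n"
  shows "proj d (s_lift f) \<in> proj d ` NR_span d n b"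
proof -
  let ?V = "NR_span d n b :: ('k, idem_gen) free_alg set"
  let ?p = "s_lift f * (\<Sum>j\<le>d. word [generator b j])"
  have "s_lift f * word [generator b j] \<in> fa.span (?V \<union> rel_ideal d)" if "j \<le> d" for j
  proof -
    have "word ` NR_words d (Suc n) (generator b j) \<subseteq> ?V"
      using that by (auto simp: NR_span_def intro!: fa.span_base)
    then show ?thesis
      using s_lift_mult_generator[OF assms that, of b]
      by (meson Un_mono fa.span_mono order_refl subsetD)
  qed
  then have "?p \<in> fa.span (?V \<union> rel_ideal d)"
    unfolding sum_distrib_left by (intro fa.span_sum) simp
  moreover have "fa.span ?V = ?V" "fa.span (rel_ideal d) = (rel_ideal d :: ('k, idem_gen) free_alg set)"
    using subspace_rel_ideal by (simp_all only: NR_span_def fa.span_span fa.span_eq_iff)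
  ultimately obtain u v where uv: "?p = u + v" "u \<in> ?V" "v \<in> rel_ideal d"
    unfolding fa.span_Un by auto
  have "s_lift f * (1 - (\<Sum>j\<le>d. word [generator b j])) \<in> rel_ideal d"
    using assms F_comp_subset by (intro rel_ideal_mult sum_generators s_lift_B) blast
  then have "(s_lift f - ?p) + v \<in> rel_ideal d"
    using uv(3) by (intro rel_ideal_add) (simp_all add: right_diff_distrib)
  then have "proj d (s_lift f) = proj d u"
    unfolding proj_eq_iff uv(1) by simp
  then show ?thesis using uv(2) by blast
qed

text \<open>The start vector stands for 1, so these are the coordinates of f e_j and of f
  e*_j.\<close>

lemma act_s_lift_generator:
  assumes "f \<in> FA {1..d}" "j \<le> d" "k \<le> d"
  shows "act d (const_vec d 1) (s_lift f * N j) k = (if k = j then f else 0)"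
    and "act d (const_vec d 1) (s_lift f * S j) k = f * ((if k = j then 1 else 0) - s_word d j)"
  using assms
  by (simp_all add: act_mult act_s_lift step_def coeff_const_vec) (simp add: const_vec_def)

lemma NR_spaces_Int:
  "NR_space d (n + 1) \<inter> NR_space_star d (n + 1) = (\<lambda>p. proj d (s_lift p)) ` F_comp d n"
  (is "?L = (?R :: ('k::field, idem_gen) free_alg set set)")
proof
  show "?R \<subseteq> ?L"
    unfolding NR_space_eq NR_space_star_eq using s_lift_in_NR_span by blast
  show "?L \<subseteq> ?R"
  proof
    fix X assume X: "X \<in> ?L"
    obtain p where p: "p \<in> NR_span d n False" "X = proj d p"
      using X unfolding NR_space_eq by blast
    obtain p' where p': "p' \<in> NR_span d n True" "X = proj d p'"
      using X unfolding NR_space_star_eq by blast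
    obtain f where f: "\<And>j. f j \<in> F_comp d n" "p - (\<Sum>j\<le>d. s_lift (f j) * N j) \<in> rel_ideal d"
      using NR_span_cong[OF p(1)] unfolding if_False by blast
    obtain g where g: "\<And>j. g j \<in> F_comp d n" "p' - (\<Sum>j\<le>d. s_lift (g j) * S j) \<in> rel_ideal d"
      using NR_span_cong[OF p'(1)] unfolding if_True by blast
    let ?e = "(\<Sum>j\<le>d. s_lift (f j) * N j) - (\<Sum>j\<le>d. s_lift (g j) * S j)"
    have fg: "f j \<in> FA {1..d}" "g j \<in> FA {1..d}" for j
      using f(1) g(1) F_comp_subset by blast+
    have pp': "p - p' \<in> rel_ideal d"
      using p(2) p'(2) by (simp flip: proj_eq_iff)
    have "?e = (p - p') - (p - (\<Sum>j\<le>d. s_lift (f j) * N j)) + (p' - (\<Sum>j\<le>d. s_lift (g j) * S j))"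
      by simp
    then have "?e \<in> rel_ideal d"
      using rel_ideal_add[OF rel_ideal_diff[OF pp' f(2)] g(2)] by (simp only:)
    \<comment> \<open>Coordinate 0 alone suffices: it equates a sum of degree \<open>n + 1\<close>
      with g_0 - f_0, which has degree \<open>n\<close>.\<close>
    then have "act d (const_vec d 1) ?e 0 = 0"
      by (rule act_rel_ideal) (simp add: const_vec_def)
    then have "f 0 = (\<Sum>j\<le>d. g j * ((if 0 = j then 1 else 0) - s_word d j))"
      using fg by (simp add: act_right act_s_lift_generator)
    also have "\<dots> = (\<Sum>j\<le>d. (if 0 = j then g j else 0) - g j * s_word d j)"
      by (intro sum.cong) (simp_all add: right_diff_distrib)
    finally have sum: "(\<Sum>j\<le>d. g j * s_word d j) = g 0 - f 0"
      by (simp add: sum_subtractf)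
    have "g j * s_word d j \<in> F_comp d (n + 1)" if "j \<le> d" for j
      using that by (intro F_comp_mult g s_word_F_comp)
    then have "(\<Sum>j\<le>d. g j * s_word d j) \<in> F_comp d (n + 1)"
      by (intro fa.span_sum) simp
    moreover have "(\<Sum>j\<le>d. g j * s_word d j) \<in> F_comp d n"
      unfolding sum by (intro fa.span_diff f g)
    ultimately have "(\<Sum>j\<le>d. g j * s_word d j) = 0"
      by (rule F_comp_disjoint) simp
    then have g0: "g j = g 0" if "j \<le> d" for j
      using that by (rule s_word_relation)
    \<comment> \<open>With a common left factor, the starred generators can be summed to 1 modulo
      the relations.\<close>
    have "(\<Sum>j\<le>d. s_lift (g j) * S j) = s_lift (g 0) * (\<Sum>j\<le>d. S j)"
      unfolding sum_distrib_left by (intro sum.cong) (auto dest: g0)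
    then have "p' - s_lift (g 0) = (p' - (\<Sum>j\<le>d. s_lift (g j) * S j)) - s_lift (g 0) * (1 - (\<Sum>j\<le>d. S j))"
      by (simp add: right_diff_distrib)
    also have "\<dots> \<in> rel_ideal d"
      by (rule rel_ideal_diff[OF g(2) rel_ideal_mult(2)[OF sum_generators[where b = True, unfolded if_True] s_lift_B[OF fg(2)]]])
    finally have "X = proj d (s_lift (g 0))"
      using p' by (simp add: proj_eq_iff)
    then show "X \<in> ?R" using g(1)[of 0] by blast
  qed
qed

lemma span_F_comp_Union: "fa.span (\<Union>n. F_comp d n) = FA {1..d}"
proof
  show "fa.span (\<Union>n. F_comp d n) \<subseteq> FA {1..d}"
    using F_comp_subset by (intro fa.span_minimal subspace_FA) blast
  show "FA {1..d} \<subseteq> fa.span (\<Union>n. F_comp d n)"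
    unfolding carrier_free_algebra
    by (intro fa.span_mono) (auto intro!: fa.span_base)
qed

theorem theorem8p4:
  fixes d :: nat
  assumes "d \<ge> 1"
  shows "(s_maps d :: (('k::field, nat) free_alg \<Rightarrow> ('k, idem_gen) free_alg set) set) \<noteq> {} \<and>
    (\<forall>h \<in> (s_maps d :: (('k, nat) free_alg \<Rightarrow> ('k, idem_gen) free_alg set) set).
      inj_on h (carrier (free_algebra {1..d})) \<and>
      h ` carrier (free_algebra {1..d}) =
        lin_span (alg_A d) (\<Union>n. NR_space d (n + 1) \<inter> NR_space_star d (n + 1)) \<and>
      (\<forall>n. h ` free_component {1..d} n = NR_space d (n + 1) \<inter> NR_space_star d (n + 1)))"
proof (intro conjI ballI allI)
  show "(s_maps d :: (('k, nat) free_alg \<Rightarrow> ('k, idem_gen) free_alg set) set) \<noteq> {}"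
    using proj_s_lift_in_s_maps by blast
next
  fix h :: "('k, nat) free_alg \<Rightarrow> ('k, idem_gen) free_alg set"
  assume "h \<in> s_maps d"
  then have h: "h p = proj d (s_lift p)" if "p \<in> FA {1..d}" for p
    using that by (rule s_maps_unique)
  show "inj_on h (FA {1..d})"
    by (rule inj_onI) (simp add: h s_lift_injective)
  show "h ` free_component {1..d} n = NR_space d (n + 1) \<inter> NR_space_star d (n + 1)" for n
    unfolding free_component_eq NR_spaces_Int
    using F_comp_subset by (intro image_cong refl h) blast
  interpret Vector_Spaces.linear scl scl "s_lift :: ('k, nat) free_alg \<Rightarrow> _" by (rule linear_s_lift)
  let ?F = "\<Union>n. F_comp d n :: ('k, nat) free_alg set"
  have "s_lift ` ?F \<subseteq> B d"
    using F_comp_subset s_lift_B by blast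
  \<comment> \<open>The sum of the intersections is encoded as the span of their union. The union is
    the image of the homogeneous components, and these span F.\<close>
  then have "lin_span (alg_A d) (proj d ` s_lift ` ?F) = proj d ` s_lift ` FA {1..d}"
    by (simp add: lin_span_alg_A span_image span_F_comp_Union)
  moreover have "proj d ` s_lift ` ?F = (\<Union>n. NR_space d (n + 1) \<inter> NR_space_star d (n + 1))"
    unfolding NR_spaces_Int by (simp add: image_UN image_image)
  moreover have "h ` FA {1..d} = proj d ` s_lift ` FA {1..d}"
    by (simp add: image_image h)
  ultimately show "h ` FA {1..d} = lin_span (alg_A d) (\<Union>n. NR_space d (n + 1) \<inter> NR_space_star d (n + 1))"
    by simp
qed

end
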